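(* Let $t_1,\dots,t_5\in\mathbb{C}^*$ and $t_6,t_7\in\mathbb{C}$, and suppose that the cubic threefold $X\subset\mathbb{P}^4_{\mathbb{C}}$ defined by $$F=t_1x_1^3+t_2x_2^3+t_3x_3^3+t_4x_4^3+t_5x_5^3+t_6x_1x_2x_3+t_7x_2x_4x_5$$ is smooth. Let $G=\langle[A_1],[A_2]\rangle\subset\mathrm{PGL}(5,\mathbb{C})$, where $$A_1=\mathrm{diag}(\xi_3,1,\xi_3^2,1,1),\qquad A_2=\mathrm{diag}(1,\xi_3,\xi_3^2,\xi_3^2,1).$$ Then the quotient variety $X/G$ is birational to the smooth cubic threefold in $\mathbb{P}^4$ defined by $$t_1x_1^2x_3+t_2x_2^3+t_3x_1x_3^2+t_4x_4^2x_5+t_5x_4x_5^2+t_6x_1x_2x_3+t_7x_2x_4x_5$$ (in particular this cubic threefold is smooth). In particular, if $X$ is the Fermat cubic threefold $\{\sum_{i=1}^5x_i^3=0\}$, then $X/G$ is birational to $X$.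
   Context: $\mathbb{C}^*=\mathbb{C}\setminus\{0\}$ and $\xi_3$ is a primitive third root of unity. $[A]$ denotes the class in $\mathrm{PGL}(5,\mathbb{C})$ of an invertible matrix $A$. The class of a diagonal matrix $\mathrm{diag}(\lambda_1,\dots,\lambda_5)$ acts on $\mathbb{P}^4$ by $(x_1:\cdots:x_5)\mapsto(\lambda_1x_1:\cdots:\lambda_5x_5)$; the group $G$ preserves $X$. *)

theory Defs
  imports "HOL-Analysis.Analysis" "HOL-Algebra.Generated_Groups"
begin

section \<open>Projective space and projective varieties\<close>

text \<open>
  A point of the projective space with homogeneous coordinates indexed by \<open>'n\<close> is a
  line through the origin of \<open>complex ^ 'n\<close>; the dimension is \<open>CARD('n) - 1\<close>.
\<close>

type_synonym 'n pt = "(complex ^ 'n) set"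

definition hpt :: "complex ^ 'n \<Rightarrow> 'n pt" where
  "hpt x = vec.span {x}"

definition projective_space :: "'n::finite pt set" where
  "projective_space = hpt ` {x. x \<noteq> 0}"

text \<open>
  Polynomials are represented by polynomial functions, which is faithful since the ground field
  is infinite.
\<close>

definition homogeneous :: "nat \<Rightarrow> (complex ^ 'n::finite \<Rightarrow> complex) \<Rightarrow> bool" where
  "homogeneous d f \<longleftrightarrow>
     (\<exists>c. f = (\<lambda>x. \<Sum>m | (\<Sum>i\<in>UNIV. m i) = d. c m * (\<Prod>i\<in>UNIV. (x $ i) ^ m i)))"

definition zero_locus :: "(complex ^ 'n::finite \<Rightarrow> complex) set \<Rightarrow> 'n pt set" where
  "zero_locus S = hpt ` {x. x \<noteq> 0 \<and> (\<forall>f\<in>S. f x = 0)}"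

definition zariski_open :: "'n::finite pt set \<Rightarrow> bool" where
  "zariski_open U \<longleftrightarrow>
     (\<exists>S. (\<forall>f\<in>S. \<exists>d. homogeneous d f) \<and> U = projective_space - zero_locus S)"

lemma finite_exponents: "finite {m :: 'n::finite \<Rightarrow> nat. (\<Sum>i\<in>UNIV. m i) = d}"
proof (rule finite_subset)
  show "{m :: 'n \<Rightarrow> nat. (\<Sum>i\<in>UNIV. m i) = d}
      \<subseteq> {m. \<forall>i. (i \<in> UNIV \<longrightarrow> m i \<in> {..d}) \<and> (i \<notin> UNIV \<longrightarrow> m i = 0)}"
    by (auto intro: member_le_sum)
  show "finite {m :: 'n \<Rightarrow> nat. \<forall>i. (i \<in> UNIV \<longrightarrow> m i \<in> {..d}) \<and> (i \<notin> UNIV \<longrightarrow> m i = 0)}"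
    by (rule finite_set_of_finite_funs) auto
qed

lemma homogeneous_mult:
  fixes f g :: "complex ^ 'n::finite \<Rightarrow> complex"
  assumes "homogeneous d f" "homogeneous e g"
  shows "homogeneous (d + e) (\<lambda>x. f x * g x)"
proof -
  define M where "M k = {m :: 'n \<Rightarrow> nat. (\<Sum>i\<in>UNIV. m i) = k}" for k
  define X where "X x m = (\<Prod>i\<in>UNIV. (x $ i) ^ m i)" for x :: "complex ^ 'n" and m :: "'n \<Rightarrow> nat"
  have fin: "finite (M k)" for k
    unfolding M_def by (rule finite_exponents)
  obtain a b where f: "f = (\<lambda>x. \<Sum>m\<in>M d. a m * X x m)" and g: "g = (\<lambda>x. \<Sum>m\<in>M e. b m * X x m)"
    using assms unfolding homogeneous_def M_def X_def by blast
  define s where "s p = (\<lambda>i. fst p i + snd p i)" for p :: "('n \<Rightarrow> nat) \<times> ('n \<Rightarrow> nat)"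
  have X_add: "X x (s p) = X x (fst p) * X x (snd p)" for x p
    by (simp add: X_def s_def power_add prod.distrib)
  have s: "s ` (M d \<times> M e) \<subseteq> M (d + e)"
    by (auto simp: s_def M_def sum.distrib)
  define c where "c k = (\<Sum>p\<in>{p \<in> M d \<times> M e. s p = k}. a (fst p) * b (snd p))" for k
  have "f x * g x = (\<Sum>k\<in>M (d + e). c k * X x k)" for x
  proof -
    have "f x * g x = (\<Sum>p\<in>M d \<times> M e. a (fst p) * b (snd p) * X x (s p))"
      by (simp add: f g sum_product sum.cartesian_product X_add case_prod_unfold mult_ac)
    also have "\<dots> = (\<Sum>k\<in>M (d + e). \<Sum>p\<in>{p \<in> M d \<times> M e. s p = k}. a (fst p) * b (snd p) * X x (s p))"
      by (rule sum.group [symmetric]) (use fin s in auto)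
    also have "\<dots> = (\<Sum>k\<in>M (d + e). c k * X x k)"
      by (simp add: c_def sum_distrib_right)
    finally show ?thesis .
  qed
  then show ?thesis
    unfolding homogeneous_def M_def X_def by blast
qed

lemma homogeneous_1: "homogeneous 0 (\<lambda>x :: complex ^ 'n::finite. 1)"
proof -
  have "{m :: 'n \<Rightarrow> nat. (\<Sum>i\<in>UNIV. m i) = 0} = {\<lambda>_. 0}"
    by auto
  then show ?thesis
    unfolding homogeneous_def by (intro exI [of _ "\<lambda>_. 1"]) simp
qed

lemma homogeneous_scale:
  assumes "homogeneous d f"
  shows "f (k *s x) = k ^ d * f x"
proof -
  obtain c where c: "f = (\<lambda>x. \<Sum>m | (\<Sum>i\<in>UNIV. m i) = d. c m * (\<Prod>i\<in>UNIV. (x $ i) ^ m i))"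
    using assms unfolding homogeneous_def by blast
  have "c m * (\<Prod>i\<in>UNIV. ((k *s x) $ i) ^ m i) = k ^ d * (c m * (\<Prod>i\<in>UNIV. (x $ i) ^ m i))"
    if "(\<Sum>i\<in>UNIV. m i) = d" for m
  proof -
    have "(\<Prod>i\<in>UNIV. k ^ m i) = k ^ d"
      using that by (simp flip: power_sum)
    then show ?thesis
      by (simp add: power_mult_distrib prod.distrib)
  qed
  then show ?thesis
    unfolding c sum_distrib_left by (intro sum.cong) auto
qed

lemma hpt_eqD:
  assumes "hpt x = hpt y" "x \<noteq> 0"
  shows "\<exists>k. k \<noteq> 0 \<and> x = k *s y"
proof -
  have "x \<in> vec.span {y}"
    using assms(1) vec.span_base [of x "{x}"] by (simp add: hpt_def)
  then show ?thesis
    using assms(2) unfolding vec.span_singleton by (metis rangeE vec.scale_zero_left)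
qed

lemma hpt_in_zero_locus_iff:
  assumes "x \<noteq> 0" "\<forall>f\<in>S. \<exists>d. homogeneous d f"
  shows "hpt x \<in> zero_locus S \<longleftrightarrow> (\<forall>f\<in>S. f x = 0)"
proof
  assume "hpt x \<in> zero_locus S"
  then obtain y where y: "hpt x = hpt y" "\<forall>f\<in>S. f y = 0"
    unfolding zero_locus_def by blast
  then obtain k where "x = k *s y"
    using hpt_eqD assms(1) by blast
  then have "f x = 0" if "f \<in> S" for f
    using y(2) assms(2) that homogeneous_scale [of _ f k y] by auto
  then show "\<forall>f\<in>S. f x = 0" by blast
qed (use assms in \<open>auto simp: zero_locus_def\<close>)

lemma zariski_open_iff:
  "zariski_open U \<longleftrightarrow> U \<subseteq> projective_space \<and>
     (\<exists>S. (\<forall>f\<in>S. \<exists>d. homogeneous d f) \<and>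
          (\<forall>x. x \<noteq> 0 \<longrightarrow> (hpt x \<in> U \<longleftrightarrow> (\<exists>f\<in>S. f x \<noteq> 0))))"
    (is "?L \<longleftrightarrow> ?R")
proof
  assume ?L
  then obtain S where S: "\<forall>f\<in>S. \<exists>d. homogeneous d f" "U = projective_space - zero_locus S"
    unfolding zariski_open_def by blast
  then have "hpt x \<in> U \<longleftrightarrow> (\<exists>f\<in>S. f x \<noteq> 0)" if "x \<noteq> 0" for x
    using hpt_in_zero_locus_iff [OF that S(1)] that by (auto simp: projective_space_def)
  with S show ?R by (intro conjI exI [of _ S]) auto
next
  assume ?R
  then obtain S where S: "U \<subseteq> projective_space" "\<forall>f\<in>S. \<exists>d. homogeneous d f"
      "\<And>x. x \<noteq> 0 \<Longrightarrow> hpt x \<in> U \<longleftrightarrow> (\<exists>f\<in>S. f x \<noteq> 0)"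
    by blast
  have "U = projective_space - zero_locus S"
    using S(1) S(3) hpt_in_zero_locus_iff [OF _ S(2)] by (auto simp: projective_space_def)
  with S(2) show ?L
    unfolding zariski_open_def by blast
qed

lemma zariski_openI:
  assumes "U \<subseteq> projective_space" "\<And>f. f \<in> S \<Longrightarrow> \<exists>d. homogeneous d f"
    and "\<And>x. x \<noteq> 0 \<Longrightarrow> hpt x \<in> U \<longleftrightarrow> (\<exists>f\<in>S. f x \<noteq> 0)"
  shows "zariski_open U"
proof -
  have "\<forall>f\<in>S. \<exists>d. homogeneous d f" using assms(2) ..
  moreover have "\<forall>x. x \<noteq> 0 \<longrightarrow> (hpt x \<in> U \<longleftrightarrow> (\<exists>f\<in>S. f x \<noteq> 0))"
    by (intro allI impI assms(3))
  ultimately show ?thesis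
    unfolding zariski_open_iff using assms(1) by (intro conjI exI [of _ S])
qed

lemma zariski_openE:
  assumes "zariski_open U"
  obtains S where "U \<subseteq> projective_space" "\<forall>f\<in>S. \<exists>d. homogeneous d f"
    "\<forall>x. x \<noteq> 0 \<longrightarrow> (hpt x \<in> U \<longleftrightarrow> (\<exists>f\<in>S. f x \<noteq> 0))"
  using assms unfolding zariski_open_iff by blast

lemma zariski_open_Int:
  fixes U V :: "'n::finite pt set"
  assumes "zariski_open U" "zariski_open V"
  shows "zariski_open (U \<inter> V)"
proof -
  obtain S where S: "U \<subseteq> projective_space" "\<forall>f\<in>S. \<exists>d. homogeneous d f"
      "\<forall>x. x \<noteq> 0 \<longrightarrow> (hpt x \<in> U \<longleftrightarrow> (\<exists>f\<in>S. f x \<noteq> 0))"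
    using assms(1) by (rule zariski_openE)
  obtain T where T: "V \<subseteq> projective_space" "\<forall>f\<in>T. \<exists>d. homogeneous d f"
      "\<forall>x. x \<noteq> 0 \<longrightarrow> (hpt x \<in> V \<longleftrightarrow> (\<exists>f\<in>T. f x \<noteq> 0))"
    using assms(2) by (rule zariski_openE)
  define P where "P f g = (\<lambda>x. f x * g x)" for f g :: "complex ^ 'n \<Rightarrow> complex"
  define R where "R = {P f g | f g. f \<in> S \<and> g \<in> T}"
  have R1: "\<exists>d. homogeneous d h" if h: "h \<in> R" for h
  proof -
    obtain f g where fg: "h = P f g" "f \<in> S" "g \<in> T"
      using h unfolding R_def by blast
    with S(2) T(2) obtain d e where "homogeneous d f" "homogeneous e g"
      by blast
    then have "homogeneous (d + e) h"
      unfolding fg(1) P_def by (rule homogeneous_mult)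
    then show ?thesis ..
  qed
  have R2: "hpt x \<in> U \<inter> V \<longleftrightarrow> (\<exists>h\<in>R. h x \<noteq> 0)" if x: "x \<noteq> 0" for x
  proof -
    have "(\<exists>h\<in>R. h x \<noteq> 0) \<longleftrightarrow> (\<exists>f\<in>S. \<exists>g\<in>T. P f g x \<noteq> 0)"
      unfolding R_def by blast
    also have "\<dots> \<longleftrightarrow> (\<exists>f\<in>S. f x \<noteq> 0) \<and> (\<exists>g\<in>T. g x \<noteq> 0)"
      by (auto simp: P_def)
    finally show ?thesis
      using S(3) T(3) x by simp
  qed
  have "U \<inter> V \<subseteq> projective_space"
    using S(1) by blast
  then show ?thesis
    using R1 R2 by (rule zariski_openI)
qed

lemma zariski_open_Union:
  fixes K :: "'n::finite pt set set"
  assumes K: "\<forall>U\<in>K. zariski_open U"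
  shows "zariski_open (\<Union>K)"
proof -
  define Q where "Q U S \<longleftrightarrow> (\<forall>f\<in>S. \<exists>d. homogeneous d f) \<and>
      (\<forall>x. x \<noteq> 0 \<longrightarrow> (hpt x \<in> U \<longleftrightarrow> (\<exists>f\<in>S. f x \<noteq> 0)))"
    for U and S :: "(complex ^ 'n \<Rightarrow> complex) set"
  have "\<forall>U\<in>K. \<exists>S. Q U S"
    using K unfolding Q_def zariski_open_iff by simp
  then obtain S where S: "\<forall>U\<in>K. Q U (S U)"
    by (rule bchoice [THEN exE])
  have S1: "\<exists>d. homogeneous d f" if "U \<in> K" "f \<in> S U" for U f
    using S that unfolding Q_def by simp
  have S2: "hpt x \<in> U \<longleftrightarrow> (\<exists>f\<in>S U. f x \<noteq> 0)" if "U \<in> K" "x \<noteq> 0" for U x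
    using S that unfolding Q_def by simp
  have "\<Union>K \<subseteq> projective_space"
    using K unfolding zariski_open_iff by (simp add: Sup_le_iff)
  then show ?thesis
  proof (rule zariski_openI [of _ "\<Union>(S ` K)"])
    show "\<exists>d. homogeneous d f" if f: "f \<in> \<Union>(S ` K)" for f
    proof -
      obtain U where "U \<in> K" "f \<in> S U" using f by blast
      then show ?thesis by (rule S1)
    qed
    show "hpt x \<in> \<Union>K \<longleftrightarrow> (\<exists>f\<in>\<Union>(S ` K). f x \<noteq> 0)" if "x \<noteq> 0" for x
      using S2 [OF _ that] by simp
  qed
qed

lemma istopology_zariski_open: "istopology (zariski_open :: 'n::finite pt set \<Rightarrow> bool)"
  unfolding istopology_def by (intro conjI allI impI zariski_open_Int zariski_open_Union)

definition zariski :: "'n::finite pt topology" where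
  "zariski = topology zariski_open"

text \<open>
  A space with functions: a topological space with a specification of which complex-valued
  functions are regular on which open sets. Only the values of a function on the open set in
  question matter.
\<close>

record 'a fspace =
  topo :: "'a topology"
  reg :: "'a set \<Rightarrow> ('a \<Rightarrow> complex) \<Rightarrow> bool"

definition proj_variety :: "'n::finite pt set \<Rightarrow> 'n pt fspace" where
  "proj_variety X = \<lparr>
     topo = subtopology zariski X,
     reg = (\<lambda>U f. \<forall>p\<in>U. \<exists>W d g h.
        openin (subtopology zariski X) W \<and> p \<in> W \<and> W \<subseteq> U \<and>
        homogeneous d g \<and> homogeneous d h \<and>
        (\<forall>x. x \<noteq> 0 \<and> hpt x \<in> W \<longrightarrow> h x \<noteq> 0 \<and> f (hpt x) = g x / h x))\<rparr>"

definition fmorphism :: "'a fspace \<Rightarrow> 'b fspace \<Rightarrow> ('a \<Rightarrow> 'b) \<Rightarrow> bool" where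
  "fmorphism X Y \<phi> \<longleftrightarrow>
     continuous_map (topo X) (topo Y) \<phi> \<and>
     (\<forall>V f. openin (topo Y) V \<and> reg Y V f \<longrightarrow>
        reg X {x \<in> topspace (topo X). \<phi> x \<in> V} (f \<circ> \<phi>))"

definition fisomorphic :: "'a fspace \<Rightarrow> 'b fspace \<Rightarrow> bool" where
  "fisomorphic X Y \<longleftrightarrow>
     (\<exists>\<phi> \<psi>. fmorphism X Y \<phi> \<and> fmorphism Y X \<psi> \<and>
        (\<forall>x\<in>topspace (topo X). \<psi> (\<phi> x) = x) \<and>
        (\<forall>y\<in>topspace (topo Y). \<phi> (\<psi> y) = y))"

definition open_subspace :: "'a fspace \<Rightarrow> 'a set \<Rightarrow> 'a fspace" where
  "open_subspace X U = \<lparr>topo = subtopology (topo X) U, reg = reg X\<rparr>"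

text \<open>
  For irreducible spaces, dense open subsets are the same as nonempty open subsets.
\<close>

definition birational :: "'a fspace \<Rightarrow> 'b fspace \<Rightarrow> bool" where
  "birational X Y \<longleftrightarrow>
     (\<exists>U V. openin (topo X) U \<and> Abstract_Topology.closure_of (topo X) U = topspace (topo X) \<and>
            openin (topo Y) V \<and> Abstract_Topology.closure_of (topo Y) V = topspace (topo Y) \<and>
            fisomorphic (open_subspace X U) (open_subspace Y V))"


section \<open>Smooth hypersurfaces\<close>

abbreviation hypersurface :: "(complex ^ 'n::finite \<Rightarrow> complex) \<Rightarrow> 'n pt set" where
  "hypersurface F \<equiv> zero_locus {F}"

definition partial_deriv ::
    "'n::finite \<Rightarrow> (complex ^ 'n \<Rightarrow> complex) \<Rightarrow> complex ^ 'n \<Rightarrow> complex" where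
  "partial_deriv i F x = deriv (\<lambda>z. F (x + z *s axis i 1)) 0"

text \<open>The Jacobian criterion for the hypersurface defined by the form \<open>F\<close>.\<close>

definition smooth_hypersurface :: "(complex ^ 'n::finite \<Rightarrow> complex) \<Rightarrow> bool" where
  "smooth_hypersurface F \<longleftrightarrow>
     (\<forall>x. x \<noteq> 0 \<and> F x = 0 \<longrightarrow> (\<exists>i. partial_deriv i F x \<noteq> 0))"


section \<open>The projective linear group and quotient varieties\<close>

definition GL :: "(complex ^ 'n::finite ^ 'n) monoid" where
  "GL = \<lparr>carrier = {A. invertible A}, mult = (**), one = mat 1\<rparr>"

lemma group_GL: "group GL"
proof (rule groupI)
  fix A :: "complex ^ 'n ^ 'n"
  assume "A \<in> carrier GL"
  then obtain B where "A ** B = mat 1" "B ** A = mat 1"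
    by (auto simp: GL_def invertible_def)
  then show "\<exists>B\<in>carrier GL. B \<otimes>\<^bsub>GL\<^esub> A = \<one>\<^bsub>GL\<^esub>"
    by (auto simp: GL_def invertible_def)
next
  show "\<one>\<^bsub>GL\<^esub> \<in> carrier (GL :: (complex ^ 'n ^ 'n) monoid)"
    unfolding GL_def invertible_def by (auto intro: exI [of _ "mat 1"])
qed (simp_all add: GL_def invertible_mult matrix_mul_assoc)

definition scalars :: "(complex ^ 'n::finite ^ 'n) set" where
  "scalars = {mat c | c. c \<noteq> 0}"

lemma mat_mult_right: "A ** mat c = (\<chi> i j. c * A $ i $ j)"
  for A :: "complex ^ 'n::finite ^ 'n"
  by (simp add: vec_eq_iff matrix_matrix_mult_def mat_def if_distrib if_distribR cong: if_cong)

lemma mat_mult_left: "mat c ** A = (\<chi> i j. c * A $ i $ j)"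
  for A :: "complex ^ 'n::finite ^ 'n"
  by (simp add: vec_eq_iff matrix_matrix_mult_def mat_def if_distrib if_distribR cong: if_cong)

lemma normal_scalars: "(scalars :: (complex ^ 'n::finite ^ 'n) set) \<lhd> GL"
proof -
  interpret group "GL :: (complex ^ 'n ^ 'n) monoid" by (rule group_GL)
  have mat_mat: "mat c ** mat d = (mat (c * d) :: complex ^ 'n ^ 'n)" for c d
    by (subst mat_mult_right) (simp add: mat_def vec_eq_iff)
  have sub: "subgroup (scalars :: (complex ^ 'n ^ 'n) set) GL"
  proof (rule subgroupI)
    show "scalars \<subseteq> (carrier GL :: (complex ^ 'n ^ 'n) set)"
    proof
      fix A :: "complex ^ 'n ^ 'n" assume "A \<in> scalars"
      then obtain c where "A = mat c" "c \<noteq> 0" by (auto simp: scalars_def)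
      then show "A \<in> carrier GL"
        by (auto simp: GL_def invertible_def mat_mat intro!: exI [of _ "mat (inverse c)"])
    qed
    then have sc: "mat c \<in> carrier (GL :: (complex ^ 'n ^ 'n) monoid)" if "c \<noteq> 0" for c
      using that by (auto simp: scalars_def)
    show "inv\<^bsub>GL\<^esub> A \<in> scalars" if A: "A \<in> scalars" for A :: "complex ^ 'n ^ 'n"
    proof -
      obtain c where c: "A = mat c" "c \<noteq> 0" using A by (auto simp: scalars_def)
      then have "inv\<^bsub>GL\<^esub> A = mat (inverse c)"
        using sc [of c] sc [of "inverse c"] by (intro inv_equality) (auto simp: GL_def mat_mat)
      then show ?thesis using c by (auto simp: scalars_def)
    qed
    show "scalars \<noteq> ({} :: (complex ^ 'n ^ 'n) set)"
      by (auto simp: scalars_def intro: exI [of _ 1])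
    show "A \<otimes>\<^bsub>GL\<^esub> B \<in> scalars" if "A \<in> scalars" "B \<in> scalars" for A B :: "complex ^ 'n ^ 'n"
    proof -
      obtain c d where "A = mat c" "c \<noteq> 0" "B = mat d" "d \<noteq> 0"
        using \<open>A \<in> scalars\<close> \<open>B \<in> scalars\<close> by (auto simp: scalars_def)
      then show ?thesis by (auto simp: scalars_def GL_def mat_mat intro!: exI [of _ "c * d"])
    qed
  qed
  have comm: "mat c ** A = A ** mat c" for c and A :: "complex ^ 'n ^ 'n"
    by (simp add: mat_mult_left mat_mult_right)
  have "scalars #>\<^bsub>GL\<^esub> A = A <#\<^bsub>GL\<^esub> scalars" for A :: "complex ^ 'n ^ 'n"
  proof -
    have "B \<otimes>\<^bsub>GL\<^esub> A = A \<otimes>\<^bsub>GL\<^esub> B" if "B \<in> scalars" for B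
      using that by (auto simp: GL_def scalars_def intro: comm)
    then show ?thesis by (simp add: r_coset_def l_coset_def)
  qed
  with sub show ?thesis by (intro normalI) auto
qed

definition PGL :: "(complex ^ 'n::finite ^ 'n) set monoid" where
  "PGL = GL Mod scalars"

lemma group_PGL: "group PGL"
  unfolding PGL_def by (rule normal.factorgroup_is_group [OF normal_scalars])

definition pgl_class :: "complex ^ 'n::finite ^ 'n \<Rightarrow> (complex ^ 'n ^ 'n) set" where
  "pgl_class A = scalars #>\<^bsub>GL\<^esub> A"

text \<open>
  All matrices in a class have the same image on a given line, so that the union below is
  the image of the line under any representative.
\<close>

definition pgl_act :: "(complex ^ 'n::finite ^ 'n) set \<Rightarrow> 'n pt \<Rightarrow> 'n pt" where
  "pgl_act a p = (\<Union>A\<in>a. (*v) A ` p)"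

definition orbit_of :: "(complex ^ 'n::finite ^ 'n) set set \<Rightarrow> 'n pt \<Rightarrow> 'n pt set" where
  "orbit_of G p = (\<lambda>a. pgl_act a p) ` G"

text \<open>
  The quotient by a finite group \<open>G\<close> that preserves \<open>X\<close>: the orbit space with the quotient
  topology, where a function is regular if and only if its pullback to \<open>X\<close> is regular, so
  that regular functions are the \<open>G\<close>-invariant regular functions on the preimage.
\<close>

definition quotient_variety ::
    "'n::finite pt set \<Rightarrow> (complex ^ 'n ^ 'n) set set \<Rightarrow> 'n pt set fspace" where
  "quotient_variety X G = \<lparr>
     topo = topology (\<lambda>U. U \<subseteq> orbit_of G ` X \<and>
              openin (topo (proj_variety X)) {p \<in> X. orbit_of G p \<in> U}),
     reg = (\<lambda>U f. reg (proj_variety X) {p \<in> X. orbit_of G p \<in> U} (f \<circ> orbit_of G))\<rparr>"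

lemma istopology_quotient:
  "istopology (\<lambda>U. U \<subseteq> q ` X \<and> openin (subtopology T X) {p \<in> X. q p \<in> U})"
  unfolding istopology_def
proof (intro conjI allI impI)
  fix U V
  assume "U \<subseteq> q ` X \<and> openin (subtopology T X) {p \<in> X. q p \<in> U}"
    and "V \<subseteq> q ` X \<and> openin (subtopology T X) {p \<in> X. q p \<in> V}"
  moreover have "{p \<in> X. q p \<in> U \<inter> V} = {p \<in> X. q p \<in> U} \<inter> {p \<in> X. q p \<in> V}"
    by blast
  ultimately show "U \<inter> V \<subseteq> q ` X" "openin (subtopology T X) {p \<in> X. q p \<in> U \<inter> V}"
    by auto
next
  fix K
  assume K: "\<forall>U\<in>K. U \<subseteq> q ` X \<and> openin (subtopology T X) {p \<in> X. q p \<in> U}"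
  then show "\<Union>K \<subseteq> q ` X" by blast
  have "{p \<in> X. q p \<in> \<Union>K} = (\<Union>U\<in>K. {p \<in> X. q p \<in> U})"
    by blast
  then show "openin (subtopology T X) {p \<in> X. q p \<in> \<Union>K}"
    using K by auto
qed

definition diag_mat :: "complex ^ 'n \<Rightarrow> complex ^ 'n::finite ^ 'n" where
  "diag_mat d = (\<chi> i j. if i = j then d $ i else 0)"


section \<open>The cubic forms and the group\<close>

text \<open>In the index type \<open>5\<close> the numeral \<open>5\<close> denotes \<open>0\<close>, so \<open>1, 2, 3, 4, 5\<close> are its five elements.\<close>

definition cubic_X :: "complex \<Rightarrow> complex \<Rightarrow> complex \<Rightarrow> complex \<Rightarrow> complex \<Rightarrow> complex \<Rightarrow> complex
    \<Rightarrow> complex ^ 5 \<Rightarrow> complex" where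
  "cubic_X t1 t2 t3 t4 t5 t6 t7 = (\<lambda>x.
     t1 * (x$1)^3 + t2 * (x$2)^3 + t3 * (x$3)^3 + t4 * (x$4)^3 + t5 * (x$5)^3
     + t6 * x$1 * x$2 * x$3 + t7 * x$2 * x$4 * x$5)"

definition cubic_Y :: "complex \<Rightarrow> complex \<Rightarrow> complex \<Rightarrow> complex \<Rightarrow> complex \<Rightarrow> complex \<Rightarrow> complex
    \<Rightarrow> complex ^ 5 \<Rightarrow> complex" where
  "cubic_Y t1 t2 t3 t4 t5 t6 t7 = (\<lambda>x.
     t1 * (x$1)^2 * x$3 + t2 * (x$2)^3 + t3 * x$1 * (x$3)^2 + t4 * (x$4)^2 * x$5
     + t5 * x$4 * (x$5)^2 + t6 * x$1 * x$2 * x$3 + t7 * x$2 * x$4 * x$5)"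

definition fermat_cubic :: "complex ^ 5 \<Rightarrow> complex" where
  "fermat_cubic = (\<lambda>x. \<Sum>i\<in>UNIV. (x$i)^3)"

definition primitive_root_of_unity :: "nat \<Rightarrow> complex \<Rightarrow> bool" where
  "primitive_root_of_unity n z \<longleftrightarrow> 0 < n \<and> z ^ n = 1 \<and> (\<forall>k. 0 < k \<and> k < n \<longrightarrow> z ^ k \<noteq> 1)"

definition A1 :: "complex \<Rightarrow> complex ^ 5 ^ 5" where
  "A1 \<xi> = diag_mat (vector [\<xi>, 1, \<xi>^2, 1, 1])"

definition A2 :: "complex \<Rightarrow> complex ^ 5 ^ 5" where
  "A2 \<xi> = diag_mat (vector [1, \<xi>, \<xi>^2, \<xi>^2, 1])"

definition G12 :: "complex \<Rightarrow> (complex ^ 5 ^ 5) set set" where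
  "G12 \<xi> = generate PGL {pgl_class (A1 \<xi>), pgl_class (A2 \<xi>)}"

end

theory Submission
  imports Defs "HOL-Computational_Algebra.Fundamental_Theorem_Algebra"
begin

text \<open>
  The monomial map \<open>(x1^2/x3 : x2 : x3^2/x1 : x4^2/x5 : x5^2/x4)\<close> carries \<open>cubic_X\<close> to \<open>cubic_Y\<close>,
  and where \<open>x1, x3, x4, x5\<close> do not vanish its fibres are exactly the orbits of \<open>G\<close>, which acts
  there through \<open>diag(w, 1, w^2, e, e^2)\<close> with \<open>w^3 = e^3 = 1\<close>. Over \<open>y\<close> the fibre consists of the
  points \<open>(\<alpha> y1 : y2 : \<alpha>^2 y1 : \<beta> y4 : \<beta>^2 y4)\<close> with \<open>\<alpha>^3 = y3/y1\<close> and \<open>\<beta>^3 = y5/y4\<close>, so that a form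
  restricted to the fibre is a polynomial of degree at most 2 in each of \<open>\<alpha>\<close> and \<open>\<beta>\<close> whose nine
  coefficients are forms in \<open>y\<close>; these coefficients show that open sets and regular functions
  descend. The same parametrization with \<open>\<alpha>^3 = y3/y1\<close> lifts a singular point of \<open>cubic_Y\<close> to one
  of \<open>cubic_X\<close>, with zeros in place of a pair \<open>(y1, y3)\<close> or \<open>(y4, y5)\<close> in which a coordinate
  vanishes.
\<close>

text \<open>The monomials are degree-one invariants: y1 = x1^2/x3 and y3 = x3^2/x1 satisfy y1^2 y3 =
  x1^3, y1 y3^2 = x3^3 and y1 y3 = x1 x3, and likewise for the pair (x4, x5), so each term of the
  first cubic becomes a term of the second. One obstacle is that the quotient is given only as an
  orbit space with functions: an open set or a local fraction on \<open>X\<close> need not come with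
  invariant forms. Interpolation over the nine choices of cube roots in a fibre produces forms on
  the target directly. Another obstacle is that \<open>birational\<close> asks for dense open sets,
  while irreducibility of the hypersurfaces is never established. Density of the locus where x1, x3,
  x4, x5 do not vanish comes instead from a perturbation in the classical topology, solving for x2,
  in which both forms are cubics with leading coefficient t2. In the Fermat case, u^2 v + u v^2 = u
  v (u + v) and u^3 + v^3 each have three distinct linear factors, hence are linearly equivalent, so
  the target is isomorphic to the Fermat cubic.\<close>

lemma UNIV_5: "(UNIV :: 5 set) = {1, 2, 3, 4, 5}"
proof -
  have "card {1, 2, 3, 4, 5 :: 5} = CARD(5)"
    by simp
  then show ?thesis
    by (intro card_subset_eq [symmetric]) auto
qed

lemma exhaust_5: "x = 1 \<or> x = 2 \<or> x = 3 \<or> x = 4 \<or> x = 5" for x :: 5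
  using UNIV_5 by blast

lemma forall_5: "(\<forall>i :: 5. P i) \<longleftrightarrow> P 1 \<and> P 2 \<and> P 3 \<and> P 4 \<and> P 5"
  by (metis exhaust_5)

lemma sum_5: "sum f (UNIV :: 5 set) = f 1 + f 2 + f 3 + f 4 + f 5"
  unfolding UNIV_5 by (simp add: add.assoc)

lemma prod_5: "prod f (UNIV :: 5 set) = f 1 * f 2 * f 3 * f 4 * f 5"
  unfolding UNIV_5 by (simp add: mult.assoc)

lemma vector_5 [simp]:
  "(vector [a, b, c, d, e] :: 'a::zero ^ 5) $ 1 = a"
  "(vector [a, b, c, d, e] :: 'a ^ 5) $ 2 = b"
  "(vector [a, b, c, d, e] :: 'a ^ 5) $ 3 = c"
  "(vector [a, b, c, d, e] :: 'a ^ 5) $ 4 = d"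
  "(vector [a, b, c, d, e] :: 'a ^ 5) $ 5 = e"
  "(vector [a, b, c, d, e] :: 'a ^ 5) $ 0 = e"
  by (simp_all add: vector_def)

lemma vec_eq_5: "x = y \<longleftrightarrow> x $ 1 = y $ 1 \<and> x $ 2 = y $ 2 \<and> x $ 3 = y $ 3 \<and> x $ 4 = y $ 4 \<and> x $ 5 = y $ 5"
  for x y :: "'a ^ 5"
  by (simp add: vec_eq_iff forall_5)

section \<open>Forms\<close>

lemma homogeneous_0: "homogeneous d (\<lambda>x. 0)"
  unfolding homogeneous_def by (intro exI [of _ "\<lambda>_. 0"]) simp

lemma homogeneous_monomial:
  fixes m :: "'n::finite \<Rightarrow> nat"
  assumes "(\<Sum>i\<in>UNIV. m i) = d"
  shows "homogeneous d (\<lambda>x. \<Prod>i\<in>UNIV. (x $ i) ^ m i)"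
  unfolding homogeneous_def
proof (intro exI ext)
  fix x :: "complex ^ 'n"
  have "(\<Sum>k | (\<Sum>i\<in>UNIV. k i) = d. (if k = m then 1 else 0) * (\<Prod>i\<in>UNIV. (x $ i) ^ k i))
      = (\<Sum>k | (\<Sum>i\<in>UNIV. k i) = d. if k = m then (\<Prod>i\<in>UNIV. (x $ i) ^ m i) else 0)"
    by (intro sum.cong) auto
  also have "\<dots> = (\<Prod>i\<in>UNIV. (x $ i) ^ m i)"
    using assms by (subst sum.delta [OF finite_exponents]) simp
  finally show "(\<Prod>i\<in>UNIV. (x $ i) ^ m i) =
      (\<Sum>k | (\<Sum>i\<in>UNIV. k i) = d. (if k = m then 1 else 0) * (\<Prod>i\<in>UNIV. (x $ i) ^ k i))"
    by simp
qed

lemma homogeneous_add: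
  assumes "homogeneous d f" "homogeneous d g"
  shows "homogeneous d (\<lambda>x. f x + g x)"
proof -
  obtain a b where
    "f = (\<lambda>x. \<Sum>m | (\<Sum>i\<in>UNIV. m i) = d. a m * (\<Prod>i\<in>UNIV. (x $ i) ^ m i))"
    "g = (\<lambda>x. \<Sum>m | (\<Sum>i\<in>UNIV. m i) = d. b m * (\<Prod>i\<in>UNIV. (x $ i) ^ m i))"
    using assms unfolding homogeneous_def by blast
  then show ?thesis
    unfolding homogeneous_def
    by (intro exI [of _ "\<lambda>m. a m + b m"]) (simp add: sum.distrib distrib_right)
qed

lemma homogeneous_cmult:
  assumes "homogeneous d f"
  shows "homogeneous d (\<lambda>x. c * f x)"
proof -
  obtain a where
    "f = (\<lambda>x. \<Sum>m | (\<Sum>i\<in>UNIV. m i) = d. a m * (\<Prod>i\<in>UNIV. (x $ i) ^ m i))"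
    using assms unfolding homogeneous_def by blast
  then show ?thesis
    unfolding homogeneous_def
    by (intro exI [of _ "\<lambda>m. c * a m"]) (simp add: sum_distrib_left mult.assoc)
qed

lemma homogeneous_sum:
  assumes "\<And>k. k \<in> A \<Longrightarrow> homogeneous d (f k)"
  shows "homogeneous d (\<lambda>x. \<Sum>k\<in>A. f k x)"
  using assms
  by (induction A rule: infinite_finite_induct) (auto intro: homogeneous_0 homogeneous_add)

lemma homogeneous_coord: "homogeneous 1 (\<lambda>x :: complex ^ 'n::finite. x $ i)"
proof -
  have "(\<Prod>j\<in>UNIV. (x $ j) ^ (if j = i then 1 else 0)) = x $ i" for x :: "complex ^ 'n"
  proof -
    have "(\<Prod>j\<in>UNIV. (x $ j) ^ (if j = i then 1 else 0)) = (\<Prod>j\<in>UNIV. if j = i then x $ j else 1)"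
      by (intro prod.cong) auto
    then show ?thesis by simp
  qed
  then show ?thesis
    using homogeneous_monomial [of "\<lambda>j. if j = i then 1 else 0" 1] by simp
qed

lemma homogeneous_power:
  assumes "homogeneous d f"
  shows "homogeneous (n * d) (\<lambda>x. f x ^ n)"
proof (induction n)
  case 0
  then show ?case by (simp add: homogeneous_1)
next
  case (Suc n)
  then show ?case using homogeneous_mult [OF assms] by simp
qed

lemma homogeneous_prod:
  assumes "finite A" "\<And>k. k \<in> A \<Longrightarrow> homogeneous (d k) (f k)"
  shows "homogeneous (\<Sum>k\<in>A. d k) (\<lambda>x. \<Prod>k\<in>A. f k x)"
  using assms by (induction A rule: finite_induct) (auto intro: homogeneous_1 homogeneous_mult)

lemma homogeneous_compose:
  fixes f :: "complex ^ 'm::finite \<Rightarrow> complex" and \<Phi> :: "complex ^ 'n::finite \<Rightarrow> complex ^ 'm"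
  assumes "homogeneous d f" "\<And>i. homogeneous e (\<lambda>x. \<Phi> x $ i)"
  shows "homogeneous (d * e) (\<lambda>x. f (\<Phi> x))"
proof -
  obtain a where a:
    "f = (\<lambda>x. \<Sum>m | (\<Sum>i\<in>UNIV. m i) = d. a m * (\<Prod>i\<in>UNIV. (x $ i) ^ m i))"
    using assms(1) unfolding homogeneous_def by blast
  have "homogeneous (d * e) (\<lambda>x. \<Prod>i\<in>UNIV. (\<Phi> x $ i) ^ m i)" if "(\<Sum>i\<in>UNIV. m i) = d" for m
    using homogeneous_prod [of UNIV "\<lambda>i. m i * e" "\<lambda>i x. (\<Phi> x $ i) ^ m i"]
      homogeneous_power [OF assms(2)] that by (simp flip: sum_distrib_right)
  then show ?thesis
    unfolding a by (intro homogeneous_sum homogeneous_cmult) auto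
qed

lemma continuous_on_homogeneous:
  assumes "homogeneous d f"
  shows "continuous_on UNIV f"
proof -
  obtain a where
    "f = (\<lambda>x. \<Sum>m | (\<Sum>i\<in>UNIV. m i) = d. a m * (\<Prod>i\<in>UNIV. (x $ i) ^ m i))"
    using assms unfolding homogeneous_def by blast
  then show ?thesis
    by (auto intro!: continuous_intros)
qed

text \<open>The closure rules build degrees as unevaluated sums such as \<open>(1 + 1) + 1\<close>;
  this rule normalises them afterwards.\<close>

lemma homogeneous_eqI: "homogeneous d f \<Longrightarrow> d = e \<Longrightarrow> (\<And>x. f x = g x) \<Longrightarrow> homogeneous e g"
  by (metis ext)

lemmas homogeneous_intros =
  homogeneous_add homogeneous_cmult homogeneous_mult homogeneous_power homogeneous_coord

section \<open>Projective varieties and their maps\<close>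

lemma hpt_scale: "k \<noteq> 0 \<Longrightarrow> hpt (k *s x) = hpt x"
  unfolding hpt_def by (rule vec.span_image_scale [of "{x}" "\<lambda>_. k", simplified])

lemma zero_locus_subset: "zero_locus S \<subseteq> projective_space"
  by (auto simp: zero_locus_def projective_space_def)

lemma hpt_in_hypersurface_iff:
  "homogeneous d F \<Longrightarrow> x \<noteq> 0 \<Longrightarrow> hpt x \<in> hypersurface F \<longleftrightarrow> F x = 0"
  by (subst hpt_in_zero_locus_iff) auto

lemma projective_space_cases:
  assumes "p \<in> projective_space"
  obtains x where "x \<noteq> 0" "p = hpt x"
  using assms unfolding projective_space_def by blast

lemma openin_zariski: "openin zariski = (zariski_open :: 'n::finite pt set \<Rightarrow> bool)"
  unfolding zariski_def by (rule topology_inverse' [OF istopology_zariski_open])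

text \<open>Whether a form vanishes does not depend on the representative of a line, so openness can
  be tested on nonzero vectors. Later openness proofs supply the set \<open>S\<close> of
  forms.\<close>

lemma openin_proj_variety_iff:
  fixes X :: "'n::finite pt set"
  assumes X: "X \<subseteq> projective_space"
  shows "openin (topo (proj_variety X)) U \<longleftrightarrow> U \<subseteq> X \<and>
     (\<exists>S. (\<forall>f\<in>S. \<exists>d. homogeneous d f) \<and>
          (\<forall>x. x \<noteq> 0 \<longrightarrow> (hpt x \<in> U \<longleftrightarrow> hpt x \<in> X \<and> (\<exists>f\<in>S. f x \<noteq> 0))))"
    (is "?L \<longleftrightarrow> ?R")
proof
  assume ?L
  then obtain T where T: "zariski_open T" "U = T \<inter> X"
    unfolding proj_variety_def by (auto simp: openin_subtopology openin_zariski)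
  from T(1) show ?R
    by (rule zariski_openE) (use T(2) in blast)
next
  assume R: ?R
  then obtain S where S: "\<forall>f\<in>S. \<exists>d. homogeneous d f"
      "\<And>x. x \<noteq> 0 \<Longrightarrow> (hpt x \<in> U \<longleftrightarrow> hpt x \<in> X \<and> (\<exists>f\<in>S. f x \<noteq> 0))"
    by blast
  have "zariski_open (projective_space - zero_locus S)"
    unfolding zariski_open_def using S(1) by blast
  moreover have "p \<in> U \<longleftrightarrow> p \<in> (projective_space - zero_locus S) \<inter> X" for p
  proof (cases "p \<in> projective_space")
    case True
    then obtain x where "x \<noteq> 0" "p = hpt x" by (rule projective_space_cases)
    then show ?thesis using True S(2) hpt_in_zero_locus_iff [OF _ S(1)] by auto
  next
    case False
    then show ?thesis using R X by blast
  qed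
  ultimately show ?L
    unfolding proj_variety_def by (auto simp: openin_subtopology openin_zariski)
qed

lemma topspace_proj_variety:
  assumes "X \<subseteq> projective_space"
  shows "topspace (topo (proj_variety X)) = X"
proof -
  have "openin (topo (proj_variety X)) X"
    unfolding openin_proj_variety_iff [OF assms]
    by (auto intro!: exI [of _ "{\<lambda>_. 1}"] homogeneous_1)
  moreover have "topspace (topo (proj_variety X)) \<subseteq> X"
    by (simp add: proj_variety_def)
  ultimately show ?thesis
    using openin_subset by blast
qed

lemma reg_proj_variety_iff:
  "reg (proj_variety X) U f \<longleftrightarrow> (\<forall>p\<in>U. \<exists>W d g h.
      openin (topo (proj_variety X)) W \<and> p \<in> W \<and> W \<subseteq> U \<and> homogeneous d g \<and> homogeneous d h \<and>
      (\<forall>x. x \<noteq> 0 \<and> hpt x \<in> W \<longrightarrow> h x \<noteq> 0 \<and> f (hpt x) = g x / h x))"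
  by (simp add: proj_variety_def)

lemma openin_proj_varietyE:
  assumes "openin (topo (proj_variety X)) U" "X \<subseteq> projective_space"
  obtains S where "\<forall>f\<in>S. \<exists>d. homogeneous d f"
    "\<forall>x. x \<noteq> 0 \<longrightarrow> (hpt x \<in> U \<longleftrightarrow> hpt x \<in> X \<and> (\<exists>f\<in>S. f x \<noteq> 0))"
  using assms(1) unfolding openin_proj_variety_iff [OF assms(2)] by blast

lemma reg_proj_varietyE:
  assumes "reg (proj_variety X) U f" "p \<in> U"
  obtains W d g h where "openin (topo (proj_variety X)) W" "p \<in> W" "W \<subseteq> U"
    "homogeneous d g" "homogeneous d h"
    "\<forall>x. x \<noteq> 0 \<longrightarrow> hpt x \<in> W \<longrightarrow> h x \<noteq> 0 \<and> f (hpt x) = g x / h x"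
  using bspec [OF assms(1) [unfolded reg_proj_variety_iff] assms(2)] by blast

lemma reg_proj_variety_cong:
  assumes "\<And>p. p \<in> U \<Longrightarrow> f p = g p"
  shows "reg (proj_variety X) U f \<longleftrightarrow> reg (proj_variety X) U g"
proof -
  have "reg (proj_variety X) U g" if "reg (proj_variety X) U f" "\<And>p. p \<in> U \<Longrightarrow> f p = g p" for f g
    using that(1) unfolding reg_proj_variety_iff by (smt (verit) subsetD that(2))
  then show ?thesis using assms by metis
qed

text \<open>The arbitrary representative is harmless once the components of \<open>\<Phi>\<close>
  are forms of one common degree. At a common zero of the components the value is
  \<open>hpt 0\<close>, which is not a projective point.\<close>

definition proj_map :: "(complex ^ 'n::finite \<Rightarrow> complex ^ 'm::finite) \<Rightarrow> 'n pt \<Rightarrow> 'm pt" where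
  "proj_map \<Phi> p = hpt (\<Phi> (SOME x. x \<noteq> 0 \<and> p = hpt x))"

lemma proj_map_hpt:
  assumes "\<And>i. homogeneous e (\<lambda>x. \<Phi> x $ i)" "x \<noteq> 0"
  shows "proj_map \<Phi> (hpt x) = hpt (\<Phi> x)"
proof -
  define y where "y = (SOME y. y \<noteq> 0 \<and> hpt x = hpt y)"
  have "y \<noteq> 0 \<and> hpt x = hpt y"
    unfolding y_def by (rule someI [of _ x]) (use assms(2) in simp)
  then obtain k where k: "k \<noteq> 0" "y = k *s x"
    using hpt_eqD [of y x] by auto
  have "\<Phi> y = k ^ e *s \<Phi> x"
    unfolding k(2) vec_eq_iff using homogeneous_scale [OF assms(1)] by simp
  then show ?thesis
    unfolding proj_map_def y_def [symmetric] using k(1) by (simp add: hpt_scale)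
qed

context
  fixes \<Phi> :: "complex ^ 'n::finite \<Rightarrow> complex ^ 'm::finite" and e X Y D
  assumes \<Phi>: "\<And>i. homogeneous e (\<lambda>x. \<Phi> x $ i)"
    and X: "X \<subseteq> projective_space" and Y: "Y \<subseteq> projective_space"
    and D: "openin (topo (proj_variety X)) D"
    and maps: "\<And>x. x \<noteq> 0 \<Longrightarrow> hpt x \<in> D \<Longrightarrow> \<Phi> x \<noteq> 0 \<and> hpt (\<Phi> x) \<in> Y"
begin

text \<open>If the forms \<open>r\<close> cut out \<open>D\<close> and the forms \<open>s\<close>
  cut out \<open>W\<close>, the products \<open>r x * s (\<Phi> x)\<close> cut out the preimage. The
  factor \<open>r\<close> discards points outside \<open>D\<close>, where \<open>\<Phi>\<close> may
  vanish or leave \<open>Y\<close>.\<close>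

lemma openin_proj_map_preimage:
  assumes "openin (topo (proj_variety Y)) W"
  shows "openin (topo (proj_variety X)) {p \<in> D. proj_map \<Phi> p \<in> W}"
proof -
  obtain S where S: "\<forall>f\<in>S. \<exists>d. homogeneous d f"
      "\<And>x. x \<noteq> 0 \<Longrightarrow> (hpt x \<in> W \<longleftrightarrow> hpt x \<in> Y \<and> (\<exists>f\<in>S. f x \<noteq> 0))"
    using assms unfolding openin_proj_variety_iff [OF Y] by blast
  obtain R where R: "D \<subseteq> X" "\<forall>f\<in>R. \<exists>d. homogeneous d f"
      "\<And>x. x \<noteq> 0 \<Longrightarrow> (hpt x \<in> D \<longleftrightarrow> hpt x \<in> X \<and> (\<exists>f\<in>R. f x \<noteq> 0))"
    using D unfolding openin_proj_variety_iff [OF X] by blast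
  define Q where "Q = (\<lambda>(r, s) x. r x * s (\<Phi> x)) ` (R \<times> S)"
  have "\<exists>d. homogeneous d f" if f: "f \<in> Q" for f
  proof -
    obtain r s where rs: "f = (\<lambda>x. r x * s (\<Phi> x))" "r \<in> R" "s \<in> S"
      using f unfolding Q_def by auto
    obtain a b where ab: "homogeneous a r" "homogeneous b s"
      using rs R(2) S(1) by meson
    show ?thesis
      unfolding rs(1) using homogeneous_mult [OF ab(1) homogeneous_compose [OF ab(2) \<Phi>]] by blast
  qed
  moreover have "hpt x \<in> {p \<in> D. proj_map \<Phi> p \<in> W} \<longleftrightarrow> hpt x \<in> X \<and> (\<exists>f\<in>Q. f x \<noteq> 0)"
    if x: "x \<noteq> 0" for x
  proof -
    have "(\<exists>f\<in>Q. f x \<noteq> 0) \<longleftrightarrow> (\<exists>r\<in>R. r x \<noteq> 0) \<and> (\<exists>s\<in>S. s (\<Phi> x) \<noteq> 0)"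
      unfolding Q_def by (auto 0 3)
    then show ?thesis
      using R(3) [OF x] S(2) [of "\<Phi> x"] maps [OF x] proj_map_hpt [OF \<Phi> x] by auto
  qed
  ultimately show ?thesis
    unfolding openin_proj_variety_iff [OF X] using R(1) by blast
qed

lemma reg_proj_map_pullback:
  assumes "reg (proj_variety Y) W f"
  shows "reg (proj_variety X) {p \<in> D. proj_map \<Phi> p \<in> W} (f \<circ> proj_map \<Phi>)"
  unfolding reg_proj_variety_iff
proof
  fix p
  assume "p \<in> {p \<in> D. proj_map \<Phi> p \<in> W}"
  then have p: "p \<in> D" "proj_map \<Phi> p \<in> W" by auto
  then obtain V d g h where V: "openin (topo (proj_variety Y)) V" "proj_map \<Phi> p \<in> V" "V \<subseteq> W"
      "homogeneous d g" "homogeneous d h"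
      "\<And>x. x \<noteq> 0 \<Longrightarrow> hpt x \<in> V \<Longrightarrow> h x \<noteq> 0 \<and> f (hpt x) = g x / h x"
    using assms unfolding reg_proj_variety_iff by metis
  show "\<exists>W' d g h. openin (topo (proj_variety X)) W' \<and> p \<in> W' \<and> W' \<subseteq> {p \<in> D. proj_map \<Phi> p \<in> W} \<and>
      homogeneous d g \<and> homogeneous d h \<and>
      (\<forall>x. x \<noteq> 0 \<and> hpt x \<in> W' \<longrightarrow> h x \<noteq> 0 \<and> (f \<circ> proj_map \<Phi>) (hpt x) = g x / h x)"
  proof (intro exI conjI allI impI)
    show "openin (topo (proj_variety X)) {p \<in> D. proj_map \<Phi> p \<in> V}"
      by (rule openin_proj_map_preimage [OF V(1)])
    show "homogeneous (d * e) (\<lambda>x. g (\<Phi> x))" "homogeneous (d * e) (\<lambda>x. h (\<Phi> x))"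
      by (intro homogeneous_compose V \<Phi>)+
    show "h (\<Phi> x) \<noteq> 0" "(f \<circ> proj_map \<Phi>) (hpt x) = g (\<Phi> x) / h (\<Phi> x)"
      if "x \<noteq> 0 \<and> hpt x \<in> {p \<in> D. proj_map \<Phi> p \<in> V}" for x
      using that V(6) [of "\<Phi> x"] maps [of x] proj_map_hpt [OF \<Phi>, of x] by auto
  qed (use p V in auto)
qed

end

section \<open>The group\<close>

lemma pgl_class_eq:
  fixes A :: "complex ^ 'n::finite ^ 'n"
  shows "pgl_class A = {mat c ** A | c. c \<noteq> 0}"
  by (auto simp: pgl_class_def r_coset_def scalars_def GL_def)

lemma pgl_class_scale:
  fixes A :: "complex ^ 'n::finite ^ 'n"
  assumes "c \<noteq> 0"
  shows "pgl_class (mat c ** A) = pgl_class A"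
proof -
  have *: "mat a ** (mat b ** A) = mat (a * b) ** A" for a b
    by (simp add: mat_mult_left mult.assoc)
  have "mat b ** A = mat (b / c) ** (mat c ** A)" for b
    using assms by (simp add: *)
  moreover have "b / c \<noteq> 0" if "b \<noteq> 0" for b
    using that assms by simp
  ultimately have "pgl_class A \<subseteq> pgl_class (mat c ** A)"
    unfolding pgl_class_eq by blast
  moreover have "pgl_class (mat c ** A) \<subseteq> pgl_class A"
    unfolding pgl_class_eq using assms by (auto simp: *)
  ultimately show ?thesis by blast
qed

lemma pgl_class_in_carrier: "invertible A \<Longrightarrow> pgl_class A \<in> carrier PGL"
  for A :: "complex ^ 'n::finite ^ 'n"
  by (simp add: PGL_def carrier_FactGroup pgl_class_def GL_def)

lemma pgl_class_mult:
  fixes A B :: "complex ^ 'n::finite ^ 'n"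
  assumes "invertible A" "invertible B"
  shows "pgl_class A \<otimes>\<^bsub>PGL\<^esub> pgl_class B = pgl_class (A ** B)"
proof -
  have "A \<in> carrier GL" "B \<in> carrier GL"
    using assms by (simp_all add: GL_def)
  then show ?thesis
    using normal.rcos_sum [OF normal_scalars] by (simp add: PGL_def pgl_class_def GL_def)
qed

lemma pgl_class_one: "\<one>\<^bsub>PGL\<^esub> = pgl_class (mat 1 :: complex ^ 'n::finite ^ 'n)"
  by (auto simp: PGL_def pgl_class_eq scalars_def)

text \<open>The scalars of the class and those of the line merge into one factor, so the union over
  the class is again a single span.\<close>

lemma pgl_act_hpt:
  fixes A :: "complex ^ 'n::finite ^ 'n"
  shows "pgl_act (pgl_class A) (hpt x) = hpt (A *v x)"
proof -
  have *: "(mat c ** A) *v (k *s x) = (c * k) *s (A *v x)" for c k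
    by (simp add: mat_mult_left vec_eq_iff matrix_vector_mult_def sum_distrib_left mult_ac)
  show ?thesis
  proof (intro equalityI subsetI)
    fix v assume "v \<in> pgl_act (pgl_class A) (hpt x)"
    then obtain c k where "v = (mat c ** A) *v (k *s x)"
      by (auto simp: pgl_act_def pgl_class_eq hpt_def vec.span_singleton)
    then show "v \<in> hpt (A *v x)"
      unfolding * hpt_def by (auto intro: vec.span_scale vec.span_base)
  next
    fix v assume "v \<in> hpt (A *v x)"
    then obtain k where "v = k *s (A *v x)"
      by (auto simp: hpt_def vec.span_singleton)
    then have "v = (mat 1 ** A) *v (k *s x)"
      using * [of 1 k] by simp
    moreover have "mat 1 ** A \<in> pgl_class A"
      unfolding pgl_class_eq by (intro CollectI exI [of _ 1]) simp
    moreover have "k *s x \<in> hpt x"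
      unfolding hpt_def vec.span_singleton by (rule rangeI)
    ultimately show "v \<in> pgl_act (pgl_class A) (hpt x)"
      unfolding pgl_act_def by blast
  qed
qed

lemma diag_mat_vec: "diag_mat a *v x = (\<chi> i. a $ i * x $ i)"
proof -
  have "(\<Sum>j\<in>UNIV. (if i = j then a $ i else 0) * x $ j) = a $ i * x $ i" for i
    by (subst sum.remove [of _ i]) (auto intro!: sum.neutral)
  then show ?thesis
    by (simp add: diag_mat_def matrix_vector_mult_def)
qed

lemma diag_mat_mult: "diag_mat a ** diag_mat b = diag_mat (\<chi> i. a $ i * b $ i)"
proof -
  have "(\<Sum>k\<in>UNIV. (if i = k then a $ i else 0) * (if k = j then b $ k else 0)) =
      (if i = j then a $ i * b $ i else 0)" for i j
    by (subst sum.remove [of _ i]) (auto intro!: sum.neutral)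
  then show ?thesis
    by (simp add: diag_mat_def matrix_matrix_mult_def vec_eq_iff)
qed

lemma mat_eq_diag_mat: "mat c = diag_mat (\<chi> i. c)"
  by (simp add: diag_mat_def mat_def vec_eq_iff)

lemma invertible_diag_mat:
  assumes "\<And>i. a $ i \<noteq> 0"
  shows "invertible (diag_mat a)"
  unfolding invertible_def using assms
  by (intro exI [of _ "diag_mat (\<chi> i. inverse (a $ i))"]) (simp add: diag_mat_mult mat_eq_diag_mat)

text \<open>The second entry 1 normalises the scalar ambiguity of a class; \<open>w\<close> and
  \<open>e\<close> then vary independently over the cube roots of unity.\<close>

definition rot :: "complex \<Rightarrow> complex \<Rightarrow> complex ^ 5 ^ 5" where
  "rot w e = diag_mat (vector [w, 1, w\<^sup>2, e, e\<^sup>2])"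

lemma rot_mult: "rot w e ** rot w' e' = rot (w * w') (e * e')"
  unfolding rot_def diag_mat_mult
  by (rule arg_cong [where f = diag_mat]) (simp add: vec_eq_5 power_mult_distrib)

lemma rot_1: "rot 1 1 = mat 1"
  unfolding rot_def mat_eq_diag_mat
  by (rule arg_cong [where f = diag_mat]) (simp add: vec_eq_5)

lemma invertible_rot:
  assumes "w ^ 3 = 1" "e ^ 3 = 1"
  shows "invertible (rot w e)"
proof -
  have "\<forall>i :: 5. vector [w, 1, w\<^sup>2, e, e\<^sup>2] $ i \<noteq> (0 :: complex)"
    unfolding forall_5 using assms by auto
  then show ?thesis
    unfolding rot_def by (intro invertible_diag_mat) blast
qed

lemma rot_vec: "rot w e *v x = vector [w * x $ 1, x $ 2, w\<^sup>2 * x $ 3, e * x $ 4, e\<^sup>2 * x $ 5]"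
  by (simp add: rot_def diag_mat_vec vec_eq_5)

lemma ex_cube_root: "\<exists>a :: complex. a ^ 3 = A"
proof (cases "A = 0")
  case False
  have "exp (Ln A / 3) ^ 3 = exp (3 * (Ln A / 3))"
    using exp_of_nat_mult [of 3 "Ln A / 3"] by simp
  with False show ?thesis by (intro exI [of _ "exp (Ln A / 3)"]) simp
qed (auto intro: exI [of _ 0])

locale cube_root =
  fixes \<xi> :: complex
  assumes primitive: "primitive_root_of_unity 3 \<xi>"
begin

lemma xi3: "\<xi> ^ 3 = 1"
  using primitive by (simp add: primitive_root_of_unity_def)

lemma xi_neq: "\<xi> \<noteq> 1" "\<xi> \<noteq> 0"
  using primitive xi3 by (auto simp: primitive_root_of_unity_def dest: spec [of _ 1])

lemma xi_sq: "\<xi>\<^sup>2 = - 1 - \<xi>"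
proof -
  have "(\<xi> - 1) * (\<xi>\<^sup>2 + \<xi> + 1) = 0"
    using xi3 by (simp add: algebra_simps power2_eq_square power3_eq_cube)
  then have "\<xi>\<^sup>2 + \<xi> + 1 = 0"
    using xi_neq by simp
  then show ?thesis by algebra
qed

lemma cube_eq_1_iff: "w ^ 3 = 1 \<longleftrightarrow> w = 1 \<or> w = \<xi> \<or> w = \<xi>\<^sup>2"
proof -
  have "(w - 1) * (w - \<xi>) * (w - \<xi>\<^sup>2) = w ^ 3 - 1"
    using xi3 xi_sq by algebra
  then show ?thesis by (metis eq_iff_diff_eq_0 mult_eq_0_iff)
qed

lemma G12_eq: "G12 \<xi> = {pgl_class (rot w e) | w e. w ^ 3 = 1 \<and> e ^ 3 = 1}"
proof -
  interpret PGL: group "PGL :: (complex ^ 5 ^ 5) set monoid" by (rule group_PGL)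
  let ?R = "{pgl_class (rot w e) | w e. w ^ 3 = 1 \<and> e ^ 3 = 1}"
  have mult: "pgl_class (rot w e) \<otimes>\<^bsub>PGL\<^esub> pgl_class (rot w' e') = pgl_class (rot (w * w') (e * e'))"
    if "w ^ 3 = 1" "e ^ 3 = 1" "w' ^ 3 = 1" "e' ^ 3 = 1" for w e w' e'
    using that by (simp add: pgl_class_mult invertible_rot rot_mult)
  have carrier: "pgl_class (rot w e) \<in> carrier PGL" if "w ^ 3 = 1" "e ^ 3 = 1" for w e
    using that by (simp add: pgl_class_in_carrier invertible_rot)
  have inv_rot: "inv\<^bsub>PGL\<^esub> pgl_class (rot w e) = pgl_class (rot (w\<^sup>2) (e\<^sup>2))"
    if "w ^ 3 = 1" "e ^ 3 = 1" for w e
  proof -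
    have "(w\<^sup>2) ^ 3 = 1" "(e\<^sup>2) ^ 3 = 1" "w\<^sup>2 * w = 1" "e\<^sup>2 * e = 1"
      using that by algebra+
    then show ?thesis
      using that by (intro PGL.inv_equality) (simp_all add: mult carrier pgl_class_one rot_1)
  qed
  have xi23: "(\<xi>\<^sup>2) ^ 3 = 1"
    using xi3 by algebra
  have A1: "pgl_class (A1 \<xi>) = pgl_class (rot \<xi> 1)"
    by (simp add: A1_def rot_def)
  \<comment> \<open>Dividing by the second diagonal entry \<open>\<xi>\<close> brings
    \<open>A2\<close> to normal form, since \<open>\<xi> ^ 4 = \<xi>\<close>.\<close>
  have "A2 \<xi> = mat \<xi> ** rot (\<xi>\<^sup>2) \<xi>"
    unfolding A2_def rot_def mat_eq_diag_mat diag_mat_mult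
    by (rule arg_cong [where f = diag_mat]) (use xi3 in \<open>simp add: vec_eq_5, algebra\<close>)
  then have A2: "pgl_class (A2 \<xi>) = pgl_class (rot (\<xi>\<^sup>2) \<xi>)"
    using xi_neq by (simp add: pgl_class_scale)
  have RI: "pgl_class (rot w e) \<in> ?R" if "w ^ 3 = 1" "e ^ 3 = 1" for w e
    using that by blast
  have memR: "pgl_class (rot \<xi> 1) \<in> ?R" "pgl_class (rot (\<xi>\<^sup>2) \<xi>) \<in> ?R"
    by (rule RI; use xi3 xi23 in simp)+
  have "a \<in> ?R" if "a \<in> G12 \<xi>" for a
    using that unfolding G12_def
  proof (induction rule: generate.induct)
    case one
    show ?case unfolding pgl_class_one by (force simp flip: rot_1)
  next
    case (incl h)
    then show ?case using A1 A2 memR by auto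
  next
    case (inv h)
    then have "h \<in> ?R" using A1 A2 memR by auto
    then obtain w e where we: "w ^ 3 = 1" "e ^ 3 = 1" "h = pgl_class (rot w e)" by blast
    then have "(w\<^sup>2) ^ 3 = 1" "(e\<^sup>2) ^ 3 = 1" by (metis power_mult power_one mult.commute)+
    then show ?case
      unfolding we(3) inv_rot [OF we(1,2)] by (rule RI)
  next
    case (eng a b)
    then obtain w e w' e' where we: "w ^ 3 = 1" "e ^ 3 = 1" "a = pgl_class (rot w e)"
        "w' ^ 3 = 1" "e' ^ 3 = 1" "b = pgl_class (rot w' e')" by blast
    show ?case
      unfolding we(3,6) mult [OF we(1,2,4,5)] by (rule RI) (simp_all add: power_mult_distrib we)
  qed
  moreover have "pgl_class (rot w e) \<in> G12 \<xi>" if "w ^ 3 = 1" "e ^ 3 = 1" for w e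
  proof -
    have closed: "pgl_class (rot (w * w') (e * e')) \<in> G12 \<xi>"
      if "pgl_class (rot w e) \<in> G12 \<xi>" "pgl_class (rot w' e') \<in> G12 \<xi>"
        "w ^ 3 = 1" "e ^ 3 = 1" "w' ^ 3 = 1" "e' ^ 3 = 1" for w e w' e'
      using that generate.eng [of _ PGL] unfolding G12_def by (metis mult)
    have 0: "pgl_class (rot 1 1) \<in> G12 \<xi>"
      unfolding G12_def rot_1 pgl_class_one [symmetric] by (rule generate.one)
    have 1: "pgl_class (rot \<xi> 1) \<in> G12 \<xi>" "pgl_class (rot (\<xi>\<^sup>2) \<xi>) \<in> G12 \<xi>"
      unfolding G12_def A1 A2 by (auto intro: generate.incl)
    \<comment> \<open>The product of the two generators has first parameter
      \<open>\<xi> ^ 3 = 1\<close>; this separates the two factors of the group.\<close>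
    have 2: "pgl_class (rot (\<xi>\<^sup>2) 1) \<in> G12 \<xi>" "pgl_class (rot 1 \<xi>) \<in> G12 \<xi>"
      using closed [OF 1(1) 1(1)] closed [OF 1(1) 1(2)] xi3 xi23
      by (simp_all add: power2_eq_square power3_eq_cube mult.assoc)
    have 3: "pgl_class (rot 1 (\<xi>\<^sup>2)) \<in> G12 \<xi>"
      using closed [OF 2(2) 2(2)] xi3 by (simp add: power2_eq_square)
    have "pgl_class (rot w 1) \<in> G12 \<xi>" "pgl_class (rot 1 e) \<in> G12 \<xi>"
      using that 0 1 2 3 unfolding cube_eq_1_iff by auto
    then show ?thesis
      using closed [of w 1 1 e] that by simp
  qed
  ultimately show ?thesis by blast
qed

lemma orbit_of_G12: "orbit_of (G12 \<xi>) (hpt x) = {hpt (rot w e *v x) | w e. w ^ 3 = 1 \<and> e ^ 3 = 1}"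
proof -
  have "orbit_of (G12 \<xi>) (hpt x) =
      {pgl_act (pgl_class (rot w e)) (hpt x) | w e. w ^ 3 = 1 \<and> e ^ 3 = 1}"
    unfolding orbit_of_def G12_eq by blast
  then show ?thesis unfolding pgl_act_hpt .
qed

text \<open>One inclusion holds by closure under products. Applied to the inverse
  \<open>rot (w\<^sup>2) (e\<^sup>2)\<close> at the moved point, it yields the other.\<close>

lemma orbit_of_G12_rot:
  assumes w: "w ^ 3 = 1" and e: "e ^ 3 = 1"
  shows "orbit_of (G12 \<xi>) (hpt (rot w e *v x)) = orbit_of (G12 \<xi>) (hpt x)"
proof -
  have sub: "orbit_of (G12 \<xi>) (hpt (rot w e *v x)) \<subseteq> orbit_of (G12 \<xi>) (hpt x)"
    if "w ^ 3 = 1" "e ^ 3 = 1" for w e x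
  proof -
    have "rot w' e' *v (rot w e *v x) = rot (w' * w) (e' * e) *v x" for w' e'
      by (simp add: matrix_vector_mul_assoc rot_mult)
    with that show ?thesis
      unfolding orbit_of_G12 by (auto simp: power_mult_distrib) (metis mult_1 power_mult_distrib)
  qed
  have 1: "(w\<^sup>2) ^ 3 = 1" "(e\<^sup>2) ^ 3 = 1" "w\<^sup>2 * w = 1" "e\<^sup>2 * e = 1"
    using assms by algebra+
  then have "rot (w\<^sup>2) (e\<^sup>2) *v (rot w e *v x) = x"
    by (simp add: matrix_vector_mul_assoc rot_mult rot_1)
  with sub [OF w e, of x] sub [OF 1(1,2), of "rot w e *v x"] show ?thesis
    by auto
qed

section \<open>Interpolation over cube roots\<close>

text \<open>A polynomial of degree at most 2 that vanishes at the three distinct cube roots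
  \<open>a\<close>, \<open>\<xi> * a\<close>, \<open>\<xi>\<^sup>2 * a\<close> is zero.\<close>

lemma quadratic_eq_0:
  assumes A: "A \<noteq> 0" and c: "\<And>\<alpha>. \<alpha> ^ 3 = A \<Longrightarrow> (\<Sum>i<3. c i * \<alpha> ^ i) = 0" and i: "i < 3"
  shows "c i = (0::complex)"
proof -
  obtain a where a: "a ^ 3 = A"
    using ex_cube_root by blast
  have "a \<noteq> 0"
    using a A by auto
  have E: "c 0 + c 1 * \<alpha> + c 2 * \<alpha>\<^sup>2 = 0" if "\<alpha> ^ 3 = A" for \<alpha>
    using c [OF that] by (simp add: eval_nat_numeral)
  have "(\<xi> * a) ^ 3 = A" "(\<xi>\<^sup>2 * a) ^ 3 = A"
    unfolding a [symmetric] using xi3 by algebra+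
  note E3 = E [OF a] E [OF this(1)] E [OF this(2)]
  \<comment> \<open>Discrete Fourier inversion: adding the three equations with suitable powers of
    \<open>\<xi>\<close> as weights leaves three times one term.\<close>
  have "3 * c 0 = 0" "3 * (c 1 * a) = 0" "3 * (c 2 * a\<^sup>2) = 0"
    using E3 xi_sq xi3 by algebra+
  then have "c 0 = 0" "c 1 = 0" "c 2 = 0"
    using \<open>a \<noteq> 0\<close> by auto
  moreover have "i = 0 \<or> i = 1 \<or> i = 2"
    using i by linarith
  ultimately show ?thesis by auto
qed

text \<open>For fixed \<open>\<beta>\<close> the double sum is a quadratic in
  \<open>\<alpha>\<close> whose coefficients are quadratics in \<open>\<beta>\<close>; interpolate
  twice.\<close>

lemma biquadratic_eq_0:
  assumes "A \<noteq> 0" "B \<noteq> 0"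
    and c: "\<And>\<alpha> \<beta>. \<alpha> ^ 3 = A \<Longrightarrow> \<beta> ^ 3 = B \<Longrightarrow> (\<Sum>i<3. \<Sum>j<3. c i j * \<alpha> ^ i * \<beta> ^ j) = 0"
    and "i < 3" "j < 3"
  shows "c i j = (0::complex)"
proof -
  have "(\<Sum>j<3. c i j * \<beta> ^ j) = 0" if "\<beta> ^ 3 = B" for \<beta>
  proof (rule quadratic_eq_0 [OF \<open>A \<noteq> 0\<close> _ \<open>i < 3\<close>])
    fix \<alpha> assume "\<alpha> ^ 3 = A"
    with c that show "(\<Sum>i<3. (\<Sum>j<3. c i j * \<beta> ^ j) * \<alpha> ^ i) = 0"
      by (simp add: sum_distrib_left sum_distrib_right mult_ac)
  qed
  then show ?thesis
    by (rule quadratic_eq_0 [OF \<open>B \<noteq> 0\<close> _ \<open>j < 3\<close>])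
qed

end

section \<open>Expansion of forms along the fibres\<close>

definition sec :: "complex \<Rightarrow> complex \<Rightarrow> complex ^ 5 \<Rightarrow> complex ^ 5" where
  "sec \<alpha> \<beta> y = vector [\<alpha> * y $ 1, y $ 2, \<alpha>\<^sup>2 * y $ 1, \<beta> * y $ 4, \<beta>\<^sup>2 * y $ 4]"

text \<open>Each factor \<open>\<alpha> ^ 3\<close> is absorbed by one factor \<open>u\<close>,
  turning it into \<open>v\<close>. The bound on \<open>k\<close> ensures that there are enough
  factors \<open>u\<close>.\<close>

lemma power_reduce_mod_3:
  fixes \<alpha> u v :: complex
  assumes "\<alpha> ^ 3 * u = v" "k \<le> 3 * n"
  shows "\<alpha> ^ k * u ^ n = \<alpha> ^ (k mod 3) * (u ^ (n - k div 3) * v ^ (k div 3))"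
proof -
  have "k = k mod 3 + 3 * (k div 3)" "n = (n - k div 3) + k div 3"
    using assms(2) by simp_all
  then have "\<alpha> ^ k * u ^ n = \<alpha> ^ (k mod 3 + 3 * (k div 3)) * u ^ ((n - k div 3) + k div 3)"
    by metis
  also have "\<dots> = \<alpha> ^ (k mod 3) * (u ^ (n - k div 3) * (\<alpha> ^ 3 * u) ^ (k div 3))"
    unfolding power_add power_mult power_mult_distrib by (simp only: mult_ac)
  finally show ?thesis unfolding assms(1) .
qed

text \<open>The cube conditions are in product form, so the expansion is also meaningful where
  \<open>y $ 1\<close> or \<open>y $ 4\<close> vanishes.\<close>

definition sec_coeffs ::
    "nat \<Rightarrow> (complex ^ 5 \<Rightarrow> complex) \<Rightarrow> (nat \<Rightarrow> nat \<Rightarrow> complex ^ 5 \<Rightarrow> complex) \<Rightarrow> bool" where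
  "sec_coeffs d f P \<longleftrightarrow> (\<forall>i j. homogeneous d (P i j)) \<and>
     (\<forall>y \<alpha> \<beta>. \<alpha> ^ 3 * y $ 1 = y $ 3 \<longrightarrow> \<beta> ^ 3 * y $ 4 = y $ 5 \<longrightarrow>
        f (sec \<alpha> \<beta> y) = (\<Sum>i<3. \<Sum>j<3. P i j y * \<alpha> ^ i * \<beta> ^ j))"

text \<open>A monomial restricted to the fibre is a monomial in \<open>\<alpha>\<close>,
  \<open>\<beta>\<close> and \<open>y\<close>. Reducing the exponents modulo 3 trades a factor
  \<open>y $ 1\<close> for \<open>y $ 3\<close>, or \<open>y $ 4\<close> for \<open>y $ 5\<close>,
  one for one, so the degree in \<open>y\<close> stays \<open>d\<close>.\<close>

lemma ex_sec_coeffs: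
  assumes "homogeneous d f"
  shows "\<exists>P. sec_coeffs d f P"
proof -
  define M where "M = {m :: 5 \<Rightarrow> nat. (\<Sum>i\<in>UNIV. m i) = d}"
  obtain a where f: "f = (\<lambda>x. \<Sum>m\<in>M. a m * (\<Prod>i\<in>UNIV. (x $ i) ^ m i))"
    using assms unfolding homogeneous_def M_def by blast
  \<comment> \<open>These are the exponents of \<open>\<alpha>\<close> and \<open>\<beta>\<close> in
    the monomial \<open>m\<close> along \<open>sec\<close>. \<open>E m\<close> is what remains after
    reduction, and \<open>P i j\<close> collects the monomials with exponent residues
    \<open>i\<close> and \<open>j\<close>.\<close>
  define k l where "k m = m 1 + 2 * m 3" and "l m = m 4 + 2 * m 5" for m :: "5 \<Rightarrow> nat"
  define E where "E m y = (y $ 1 ^ (m 1 + m 3 - k m div 3) * y $ 3 ^ (k m div 3)) * y $ 2 ^ m 2 *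
      (y $ 4 ^ (m 4 + m 5 - l m div 3) * y $ 5 ^ (l m div 3))" for m and y :: "complex ^ 5"
  define P where "P i j y = (\<Sum>m\<in>M. (if k m mod 3 = i \<and> l m mod 3 = j then a m else 0) * E m y)"
    for i j y
  show ?thesis
    unfolding sec_coeffs_def
  proof (intro exI [of _ P] conjI allI impI)
    fix i j
    have "homogeneous d (E m)" if "m \<in> M" for m
    proof (rule homogeneous_eqI)
      show "homogeneous ((((m 1 + m 3 - k m div 3) * 1 + (k m div 3) * 1) + m 2 * 1) +
          ((m 4 + m 5 - l m div 3) * 1 + (l m div 3) * 1)) (E m)"
        unfolding E_def by (intro homogeneous_intros)
      \<comment> \<open>Hence the subtractions in the exponents of \<open>E\<close> do not
        truncate.\<close>
      have "k m div 3 \<le> m 1 + m 3" "l m div 3 \<le> m 4 + m 5"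
        unfolding k_def l_def by linarith+
      then show "(((m 1 + m 3 - k m div 3) * 1 + (k m div 3) * 1) + m 2 * 1) +
          ((m 4 + m 5 - l m div 3) * 1 + (l m div 3) * 1) = d"
        using that unfolding M_def sum_5 by simp
    qed simp
    then show "homogeneous d (P i j)"
      unfolding P_def by (intro homogeneous_sum homogeneous_cmult)
  next
    fix y :: "complex ^ 5" and \<alpha> \<beta> :: complex
    assume \<alpha>: "\<alpha> ^ 3 * y $ 1 = y $ 3" and \<beta>: "\<beta> ^ 3 * y $ 4 = y $ 5"
    have mono: "(\<Prod>i\<in>UNIV. (sec \<alpha> \<beta> y $ i) ^ m i) = E m y * \<alpha> ^ (k m mod 3) * \<beta> ^ (l m mod 3)" for m
    proof -
      have "(\<Prod>i\<in>UNIV. (sec \<alpha> \<beta> y $ i) ^ m i) =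
          (\<alpha> ^ k m * y $ 1 ^ (m 1 + m 3)) * y $ 2 ^ m 2 * (\<beta> ^ l m * y $ 4 ^ (m 4 + m 5))"
        unfolding prod_5 sec_def k_def l_def
        by (simp add: power_mult_distrib power_add power_mult [symmetric])
      also have "\<dots> = E m y * \<alpha> ^ (k m mod 3) * \<beta> ^ (l m mod 3)"
        unfolding E_def
        by (subst power_reduce_mod_3 [OF \<alpha>], simp add: k_def,
            subst power_reduce_mod_3 [OF \<beta>], simp add: l_def, simp only: mult_ac)
      finally show ?thesis .
    qed
    have "(\<Sum>i<3. \<Sum>j<3. P i j y * \<alpha> ^ i * \<beta> ^ j) =
        (\<Sum>i<3. \<Sum>j<3. \<Sum>m\<in>M. if k m mod 3 = i then (if l m mod 3 = j then a m * (E m y * \<alpha> ^ i * \<beta> ^ j) else 0) else 0)"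
      unfolding P_def sum_distrib_right by (intro sum.cong refl) (simp add: mult_ac)
    also have "\<dots> = (\<Sum>m\<in>M. \<Sum>i<3. \<Sum>j<3.
        if k m mod 3 = i then (if l m mod 3 = j then a m * (E m y * \<alpha> ^ i * \<beta> ^ j) else 0) else 0)"
      by (subst sum.swap [of _ M "{..<3}"]) (intro sum.cong refl sum.swap)
    also have "\<dots> = (\<Sum>m\<in>M. \<Sum>i<3. if k m mod 3 = i then
        (\<Sum>j<3. if l m mod 3 = j then a m * (E m y * \<alpha> ^ i * \<beta> ^ j) else 0) else 0)"
      by (intro sum.cong refl) auto
    also have "\<dots> = (\<Sum>m\<in>M. a m * (E m y * \<alpha> ^ (k m mod 3) * \<beta> ^ (l m mod 3)))"
      by (simp add: sum.delta')
    also have "\<dots> = f (sec \<alpha> \<beta> y)"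
      unfolding f mono ..
    finally show "f (sec \<alpha> \<beta> y) = (\<Sum>i<3. \<Sum>j<3. P i j y * \<alpha> ^ i * \<beta> ^ j)" ..
  qed
qed

section \<open>Quotient varieties\<close>

lemma openin_quotient_variety_iff:
  "openin (topo (quotient_variety X G)) U \<longleftrightarrow>
     U \<subseteq> orbit_of G ` X \<and> openin (topo (proj_variety X)) {p \<in> X. orbit_of G p \<in> U}"
  unfolding quotient_variety_def proj_variety_def fspace.simps
    topology_inverse' [OF istopology_quotient] ..

lemma reg_quotient_variety:
  "reg (quotient_variety X G) U f \<longleftrightarrow>
     reg (proj_variety X) {p \<in> X. orbit_of G p \<in> U} (f \<circ> orbit_of G)"
  by (simp add: quotient_variety_def)

lemma reg_open_subspace [simp]: "reg (open_subspace A U) = reg A"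
  by (simp add: open_subspace_def)

lemma openin_open_subspace_iff:
  "openin (topo A) U \<Longrightarrow> openin (topo (open_subspace A U)) W \<longleftrightarrow> openin (topo A) W \<and> W \<subseteq> U"
  by (simp add: open_subspace_def openin_open_subtopology)

lemma topspace_open_subspace:
  "openin (topo A) U \<Longrightarrow> topspace (topo (open_subspace A U)) = U"
  by (metis open_subspace_def fspace.select_convs(1) topspace_subtopology_subset openin_subset)

text \<open>
  If \<open>\<theta>\<close> is another quotient map on \<open>XT\<close> with the same fibres as the orbit map, the two targets
  are identified by \<open>orbit_of G p \<mapsto> \<theta> p\<close>.
\<close>

lemma quotient_variety_identification:
  assumes X: "X \<subseteq> projective_space" and XT: "XT \<subseteq> X"
    and sat: "\<And>p p'. p \<in> X \<Longrightarrow> p' \<in> XT \<Longrightarrow> orbit_of G p = orbit_of G p' \<Longrightarrow> p \<in> XT \<and> \<theta> p = \<theta> p'"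
    and fib: "\<And>p p'. p \<in> XT \<Longrightarrow> p' \<in> XT \<Longrightarrow> \<theta> p = \<theta> p' \<Longrightarrow> orbit_of G p = orbit_of G p'"
    and img: "\<theta> ` XT = V"
    and V: "openin (topo (proj_variety Y)) V"
    and top: "\<And>W. W \<subseteq> V \<Longrightarrow>
      openin (topo (proj_variety Y)) W \<longleftrightarrow> openin (topo (proj_variety X)) {p \<in> XT. \<theta> p \<in> W}"
    and reg: "\<And>W f. W \<subseteq> V \<Longrightarrow> openin (topo (proj_variety Y)) W \<Longrightarrow>
      reg (proj_variety Y) W f \<longleftrightarrow> reg (proj_variety X) {p \<in> XT. \<theta> p \<in> W} (f \<circ> \<theta>)"
  shows "openin (topo (quotient_variety X G)) (orbit_of G ` XT)"
    and "fisomorphic (open_subspace (quotient_variety X G) (orbit_of G ` XT))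
           (open_subspace (proj_variety Y) V)"
proof -
  let ?Q = "quotient_variety X G" and ?X = "proj_variety X" and ?Y = "proj_variety Y"
  define \<pi> where "\<pi> = orbit_of G"
  define U where "U = \<pi> ` XT"
  \<comment> \<open>Neither map depends on the chosen preimage: for \<open>\<phi>\<close> this is
    \<open>sat\<close>, for \<open>\<psi>\<close> it is \<open>fib\<close>.\<close>
  define \<phi> where "\<phi> u = \<theta> (inv_into XT \<pi> u)" for u
  define \<psi> where "\<psi> v = \<pi> (inv_into XT \<theta> v)" for v
  note sat = sat [folded \<pi>_def] and fib = fib [folded \<pi>_def]
  have \<phi>: "\<phi> (\<pi> p) = \<theta> p" if "p \<in> XT" for p
  proof -
    have "\<pi> p \<in> \<pi> ` XT"
      using that by (rule imageI)
    then have "inv_into XT \<pi> (\<pi> p) \<in> XT" "\<pi> (inv_into XT \<pi> (\<pi> p)) = \<pi> p"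
      by (rule inv_into_into, rule f_inv_into_f)
    then show ?thesis
      unfolding \<phi>_def using sat that XT by blast
  qed
  have \<psi>: "\<psi> (\<theta> p) = \<pi> p" if "p \<in> XT" for p
  proof -
    have "\<theta> p \<in> \<theta> ` XT"
      using that by (rule imageI)
    then have "inv_into XT \<theta> (\<theta> p) \<in> XT" "\<theta> (inv_into XT \<theta> (\<theta> p)) = \<theta> p"
      by (rule inv_into_into, rule f_inv_into_f)
    then show ?thesis
      unfolding \<psi>_def using fib that by blast
  qed
  \<comment> \<open>As \<open>XT\<close> is saturated, topology and functions of the quotient,
    defined through preimages in all of \<open>X\<close>, can be tested on
    \<open>XT\<close>.\<close>
  have pre: "{p \<in> X. \<pi> p \<in> A} = {p \<in> XT. \<pi> p \<in> A}" if "A \<subseteq> U" for A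
    using that sat XT unfolding U_def by blast
  have topQ: "openin (topo ?Q) A \<longleftrightarrow> openin (topo ?X) {p \<in> XT. \<pi> p \<in> A}" if "A \<subseteq> U" for A
    using that XT pre [OF that] unfolding openin_quotient_variety_iff U_def \<pi>_def by auto
  have pre_\<phi>: "{p \<in> XT. \<pi> p \<in> {u \<in> U. \<phi> u \<in> W}} = {p \<in> XT. \<theta> p \<in> W}" for W
    using \<phi> unfolding U_def by auto
  have pre_\<psi>: "{p \<in> XT. \<theta> p \<in> {v \<in> V. \<psi> v \<in> A}} = {p \<in> XT. \<pi> p \<in> A}" for A
    using \<psi> img by auto
  have "{p \<in> XT. \<pi> p \<in> U} = {p \<in> XT. \<theta> p \<in> V}"
    unfolding U_def using img by auto
  then have U: "openin (topo ?Q) U"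
    using topQ [of U] top [of V] V by simp
  then show "openin (topo ?Q) (orbit_of G ` XT)"
    by (simp add: U_def \<pi>_def)
  note subQ = openin_open_subspace_iff [OF U] topspace_open_subspace [OF U]
  note subY = openin_open_subspace_iff [OF V] topspace_open_subspace [OF V]
  have \<phi>_U: "\<phi> u \<in> V" "\<psi> (\<phi> u) = u" if "u \<in> U" for u
    using that \<phi> \<psi> img unfolding U_def by auto
  have \<psi>_V: "\<psi> v \<in> U" "\<phi> (\<psi> v) = v" if "v \<in> V" for v
    using that \<phi> \<psi> img unfolding U_def by auto
  have 1: "fmorphism (open_subspace ?Q U) (open_subspace ?Y V) \<phi>"
    unfolding fmorphism_def continuous_map_def subQ subY reg_open_subspace
  proof (intro conjI allI impI)
    fix W assume W: "openin (topo ?Y) W \<and> W \<subseteq> V"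
    then have "openin (topo ?X) {p \<in> XT. \<theta> p \<in> W}"
      using top by blast
    then show "openin (topo ?Q) {x \<in> U. \<phi> x \<in> W}"
      using topQ [of "{x \<in> U. \<phi> x \<in> W}"] unfolding pre_\<phi> by blast
  next
    fix W f assume W: "(openin (topo ?Y) W \<and> W \<subseteq> V) \<and> reg ?Y W f"
    have "reg ?X {p \<in> XT. \<theta> p \<in> W} (f \<circ> \<theta>)"
      using W reg by blast
    also have "?this \<longleftrightarrow> reg ?X {p \<in> XT. \<theta> p \<in> W} ((f \<circ> \<phi>) \<circ> \<pi>)"
      by (rule reg_proj_variety_cong) (simp add: \<phi>)
    also have "{p \<in> XT. \<theta> p \<in> W} = {p \<in> X. \<pi> p \<in> {u \<in> U. \<phi> u \<in> W}}"
      using pre [of "{u \<in> U. \<phi> u \<in> W}"] unfolding pre_\<phi> by blast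
    finally show "reg ?Q {x \<in> U. \<phi> x \<in> W} (f \<circ> \<phi>)"
      unfolding reg_quotient_variety \<pi>_def .
  qed (use \<phi>_U in auto)
  have open_\<psi>: "openin (topo ?Y) {x \<in> V. \<psi> x \<in> A}" if "openin (topo ?Q) A \<and> A \<subseteq> U" for A
  proof -
    have "openin (topo ?X) {p \<in> XT. \<pi> p \<in> A}"
      using topQ that by blast
    then show ?thesis
      using top [of "{x \<in> V. \<psi> x \<in> A}"] unfolding pre_\<psi> by blast
  qed
  have 2: "fmorphism (open_subspace ?Y V) (open_subspace ?Q U) \<psi>"
    unfolding fmorphism_def continuous_map_def subQ subY reg_open_subspace
  proof (intro conjI allI impI)
    fix A assume A: "openin (topo ?Q) A \<and> A \<subseteq> U"
    then show "openin (topo ?Y) {x \<in> V. \<psi> x \<in> A}" by (rule open_\<psi>)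
  next
    fix A f assume A: "(openin (topo ?Q) A \<and> A \<subseteq> U) \<and> reg ?Q A f"
    then have *: "openin (topo ?Y) {x \<in> V. \<psi> x \<in> A}"
      using open_\<psi> by blast
    have "reg ?X {p \<in> X. \<pi> p \<in> A} (f \<circ> \<pi>)"
      using A unfolding reg_quotient_variety \<pi>_def by blast
    then have "reg ?X {p \<in> XT. \<pi> p \<in> A} (f \<circ> \<pi>)"
      using A pre by simp
    also have "?this \<longleftrightarrow> reg ?X {p \<in> XT. \<pi> p \<in> A} ((f \<circ> \<psi>) \<circ> \<theta>)"
      by (rule reg_proj_variety_cong) (simp add: \<psi>)
    finally have "reg ?X {p \<in> XT. \<theta> p \<in> {v \<in> V. \<psi> v \<in> A}} ((f \<circ> \<psi>) \<circ> \<theta>)"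
      unfolding pre_\<psi> .
    with * show "reg ?Y {x \<in> V. \<psi> x \<in> A} (f \<circ> \<psi>)"
      by (subst reg) auto
  qed (use \<psi>_V in auto)
  show "fisomorphic (open_subspace ?Q (orbit_of G ` XT)) (open_subspace ?Y V)"
    unfolding fisomorphic_def \<pi>_def [symmetric] U_def [symmetric] subQ(2) subY(2)
    by (intro exI [of _ \<phi>] exI [of _ \<psi>] conjI ballI 1 2 \<phi>_U(2) \<psi>_V(2))
qed

text \<open>A nonempty open set contains a point where one of its defining forms \<open>s\<close> is
  nonzero, and every point of \<open>X\<close> with \<open>s\<close> nonzero lies in that set. So it
  suffices to move such a point into \<open>XT\<close> while keeping \<open>s\<close>
  nonzero.\<close>

lemma dense_in_proj_variety:
  assumes X: "X \<subseteq> projective_space" and XT: "XT \<subseteq> X"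
    and dense: "\<And>d s x. homogeneous d s \<Longrightarrow> x \<noteq> 0 \<Longrightarrow> hpt x \<in> X \<Longrightarrow> s x \<noteq> 0 \<Longrightarrow>
      \<exists>y. y \<noteq> 0 \<and> hpt y \<in> XT \<and> s y \<noteq> 0"
  shows "Abstract_Topology.closure_of (topo (proj_variety X)) XT = topspace (topo (proj_variety X))"
  unfolding dense_intersects_open
proof (intro allI impI)
  fix T assume T: "openin (topo (proj_variety X)) T \<and> T \<noteq> {}"
  then obtain S where S: "T \<subseteq> X" "\<forall>f\<in>S. \<exists>d. homogeneous d f"
      "\<And>x. x \<noteq> 0 \<Longrightarrow> (hpt x \<in> T \<longleftrightarrow> hpt x \<in> X \<and> (\<exists>f\<in>S. f x \<noteq> 0))"
    unfolding openin_proj_variety_iff [OF X] by blast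
  obtain x where x: "x \<noteq> 0" "hpt x \<in> T"
    using T S(1) X projective_space_cases by (metis ex_in_conv in_mono)
  then obtain s where s: "s \<in> S" "s x \<noteq> 0"
    using S(3) by blast
  then obtain d where "homogeneous d s" using S(2) by blast
  then obtain y where "y \<noteq> 0" "hpt y \<in> XT" "s y \<noteq> 0"
    using dense x S(1) s by blast
  then show "XT \<inter> T \<noteq> {}"
    using S(3) s(1) XT by blast
qed

text \<open>A nonempty open set of orbits has a nonempty open preimage in \<open>X\<close>, which
  meets \<open>XT\<close>.\<close>

lemma dense_in_quotient_variety:
  assumes dense: "Abstract_Topology.closure_of (topo (proj_variety X)) XT = topspace (topo (proj_variety X))"
  shows "Abstract_Topology.closure_of (topo (quotient_variety X G)) (orbit_of G ` XT) =
     topspace (topo (quotient_variety X G))"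
  unfolding dense_intersects_open
proof (intro allI impI)
  fix T assume T: "openin (topo (quotient_variety X G)) T \<and> T \<noteq> {}"
  then have "openin (topo (proj_variety X)) {p \<in> X. orbit_of G p \<in> T}" "{p \<in> X. orbit_of G p \<in> T} \<noteq> {}"
    unfolding openin_quotient_variety_iff by blast+
  then show "orbit_of G ` XT \<inter> T \<noteq> {}"
    using dense unfolding dense_intersects_open by blast
qed

section \<open>The monomial map\<close>

text \<open>The second coordinate is left out: the monomial map never divides by it, and the density
  argument solves for it without controlling whether it vanishes.\<close>

definition coord_prod :: "complex ^ 5 \<Rightarrow> complex" where
  "coord_prod x = x $ 1 * x $ 3 * x $ 4 * x $ 5"

text \<open>
  The rational map \<open>(x1^2/x3 : x2 : x3^2/x1 : x4^2/x5 : x5^2/x4)\<close> with denominators cleared.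
\<close>

definition cover :: "complex ^ 5 \<Rightarrow> complex ^ 5" where
  "cover x = vector [x$1 ^ 3 * (x$4 * x$5), coord_prod x * x$2, x$3 ^ 3 * (x$4 * x$5),
     x$4 ^ 3 * (x$1 * x$3), x$5 ^ 3 * (x$1 * x$3)]"

lemma homogeneous_coord_prod: "homogeneous 4 coord_prod"
proof (rule homogeneous_eqI)
  show "homogeneous (((1 + 1) + 1) + 1) (\<lambda>x :: complex ^ 5. x $ 1 * x $ 3 * x $ 4 * x $ 5)"
    by (intro homogeneous_intros)
qed (simp_all add: coord_prod_def)

lemma homogeneous_cover: "homogeneous 5 (\<lambda>x. cover x $ i)"
proof -
  have *: "homogeneous 5 (\<lambda>x :: complex ^ 5. x$i ^ 3 * (x$j * x$k))" for i j k
  proof (rule homogeneous_eqI)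
    show "homogeneous (3 * 1 + (1 + 1)) (\<lambda>x :: complex ^ 5. x$i ^ 3 * (x$j * x$k))"
      by (intro homogeneous_intros)
  qed simp_all
  have "homogeneous 5 (\<lambda>x. coord_prod x * x $ 2)"
    using homogeneous_mult [OF homogeneous_coord_prod homogeneous_coord, of 2] by simp
  with * have "\<forall>i. homogeneous 5 (\<lambda>x. cover x $ i)"
    unfolding forall_5 by (simp add: cover_def)
  then show ?thesis ..
qed

lemma coord_prod_nonzero: "coord_prod x \<noteq> 0 \<longleftrightarrow> x$1 \<noteq> 0 \<and> x$3 \<noteq> 0 \<and> x$4 \<noteq> 0 \<and> x$5 \<noteq> 0"
  by (simp add: coord_prod_def)

lemma coord_prod_nonzeroD: "coord_prod x \<noteq> 0 \<Longrightarrow> x \<noteq> 0"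
  by (auto simp: coord_prod_def)

lemma coord_prod_cover: "coord_prod x \<noteq> 0 \<Longrightarrow> coord_prod (cover x) \<noteq> 0"
  by (simp add: coord_prod_nonzero cover_def)

lemma sec_in_torus:
  assumes "coord_prod y \<noteq> 0" "\<alpha> ^ 3 * y$1 = y$3" "\<beta> ^ 3 * y$4 = y$5"
  shows "coord_prod (sec \<alpha> \<beta> y) \<noteq> 0"
  using assms by (auto simp: coord_prod_nonzero sec_def)

lemma cover_sec:
  assumes "\<alpha> ^ 3 * y$1 = y$3" "\<beta> ^ 3 * y$4 = y$5"
  shows "cover (sec \<alpha> \<beta> y) = coord_prod (sec \<alpha> \<beta> y) *s y"
  unfolding vec_eq_5 cover_def sec_def coord_prod_def vector_5 vector_smult_component assms [symmetric]
  by (simp only: power2_eq_square power3_eq_cube mult_ac)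

lemma torus_is_sec:
  assumes "coord_prod x \<noteq> 0"
  obtains \<alpha> \<beta> y where "coord_prod y \<noteq> 0" "\<alpha> ^ 3 * y$1 = y$3" "\<beta> ^ 3 * y$4 = y$5" "x = sec \<alpha> \<beta> y"
\<comment> \<open>Here \<open>y\<close> is the monomial map at \<open>x\<close> with its
  denominators, and the ratios are forced because the third coordinate of \<open>sec\<close> is
  \<open>\<alpha>\<close> times the first, and the fifth is \<open>\<beta>\<close> times the
  fourth.\<close>
proof (rule that [of "vector [x$1^2 / x$3, x$2, x$3^2 / x$1, x$4^2 / x$5, x$5^2 / x$4]"
        "x$3 / x$1" "x$5 / x$4"])
  show "x = sec (x$3 / x$1) (x$5 / x$4) (vector [x$1^2 / x$3, x$2, x$3^2 / x$1, x$4^2 / x$5, x$5^2 / x$4])"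
    using assms unfolding coord_prod_nonzero vec_eq_5
    by (simp add: sec_def field_simps power2_eq_square)
qed (use assms in \<open>auto simp: coord_prod_nonzero field_simps power2_eq_square power3_eq_cube\<close>)

lemma ex_sec:
  assumes "coord_prod y \<noteq> 0"
  obtains \<alpha> \<beta> where "\<alpha> ^ 3 * y$1 = y$3" "\<beta> ^ 3 * y$4 = y$5"
proof -
  obtain \<alpha> \<beta> where "\<alpha> ^ 3 = y$3 / y$1" "\<beta> ^ 3 = y$5 / y$4"
    using ex_cube_root by metis
  then show ?thesis
    using assms by (intro that [of \<alpha> \<beta>]) (auto simp: coord_prod_nonzero)
qed

lemma sec_scale: "sec \<alpha> \<beta> (k *s y) = k *s sec \<alpha> \<beta> y"
  by (simp add: sec_def vec_eq_5)

lemma coord_prod_rot: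
  assumes "w ^ 3 = 1" "e ^ 3 = 1"
  shows "coord_prod (rot w e *v x) = coord_prod x"
proof -
  have "coord_prod (rot w e *v x) = w ^ 3 * e ^ 3 * coord_prod x"
    unfolding coord_prod_def rot_vec vector_5 by algebra
  with assms show ?thesis by simp
qed

lemma cover_rot:
  assumes "w ^ 3 = 1" "e ^ 3 = 1"
  shows "cover (rot w e *v x) = cover x"
proof -
  have "(w * a) ^ 3 * (e * b * (e\<^sup>2 * c)) = a ^ 3 * (b * c)"
    "(w\<^sup>2 * a) ^ 3 * (e * b * (e\<^sup>2 * c)) = a ^ 3 * (b * c)"
    "(e * a) ^ 3 * (w * b * (w\<^sup>2 * c)) = a ^ 3 * (b * c)"
    "(e\<^sup>2 * a) ^ 3 * (w * b * (w\<^sup>2 * c)) = a ^ 3 * (b * c)" for a b c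
    using assms by algebra+
  then show ?thesis
    unfolding cover_def coord_prod_rot [OF assms] by (simp only: rot_vec vector_5)
qed

definition torus_part :: "(complex ^ 5 \<Rightarrow> complex) \<Rightarrow> 5 pt set" where
  "torus_part F = {p \<in> hypersurface F. \<exists>x. coord_prod x \<noteq> 0 \<and> p = hpt x}"

lemma hpt_in_torus_part_iff:
  assumes "homogeneous d F" "x \<noteq> 0"
  shows "hpt x \<in> torus_part F \<longleftrightarrow> F x = 0 \<and> coord_prod x \<noteq> 0"
proof -
  have "coord_prod x \<noteq> 0" if y: "coord_prod y \<noteq> 0" "hpt x = hpt y" for y
  proof -
    obtain k where "k \<noteq> 0" "x = k *s y"
      using hpt_eqD [OF y(2) assms(2)] by blast
    then show ?thesis using y(1) by (simp add: coord_prod_nonzero)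
  qed
  then show ?thesis
    using hpt_in_hypersurface_iff [OF assms] unfolding torus_part_def by blast
qed

lemma torus_part_cases:
  assumes "homogeneous d F" "p \<in> torus_part F"
  obtains x where "p = hpt x" "F x = 0" "coord_prod x \<noteq> 0"
  using assms hpt_in_torus_part_iff [OF assms(1) coord_prod_nonzeroD] unfolding torus_part_def by blast

lemma openin_torus_part:
  assumes "homogeneous d F"
  shows "openin (topo (proj_variety (hypersurface F))) (torus_part F)"
  unfolding openin_proj_variety_iff [OF zero_locus_subset]
  using hpt_in_torus_part_iff [OF assms] hpt_in_hypersurface_iff [OF assms] homogeneous_coord_prod
  by (intro conjI exI [of _ "{coord_prod}"]) (auto simp: torus_part_def)

section \<open>Descent of open sets and regular functions along the monomial map\<close>

text \<open>What the descent uses about the two forms: they correspond under \<open>sec\<close>, and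
  any form nonzero somewhere on a zero set is nonzero at a point of it in the torus. The latter
  provides both dense open sets for \<open>birational\<close>.\<close>

locale cyclic_cover = cube_root +
  fixes F H :: "complex ^ 5 \<Rightarrow> complex" and d :: nat
  assumes homogeneous_F: "homogeneous d F" and homogeneous_H: "homogeneous d H"
    and F_sec: "\<And>\<alpha> \<beta> y. \<alpha> ^ 3 * y$1 = y$3 \<Longrightarrow> \<beta> ^ 3 * y$4 = y$5 \<Longrightarrow> F (sec \<alpha> \<beta> y) = H y"
    and dense_F: "\<And>e s x. homogeneous e s \<Longrightarrow> F x = 0 \<Longrightarrow> s x \<noteq> 0 \<Longrightarrow>
      \<exists>y. F y = 0 \<and> s y \<noteq> 0 \<and> coord_prod y \<noteq> 0"
    and dense_H: "\<And>e s x. homogeneous e s \<Longrightarrow> H x = 0 \<Longrightarrow> s x \<noteq> 0 \<Longrightarrow>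
      \<exists>y. H y = 0 \<and> s y \<noteq> 0 \<and> coord_prod y \<noteq> 0"
begin

abbreviation "X \<equiv> hypersurface F"
abbreviation "Y \<equiv> hypersurface H"
abbreviation "XT \<equiv> torus_part F"
abbreviation "YT \<equiv> torus_part H"
abbreviation "\<theta> \<equiv> proj_map cover"

lemma theta_hpt: "x \<noteq> 0 \<Longrightarrow> \<theta> (hpt x) = hpt (cover x)"
  by (rule proj_map_hpt [OF homogeneous_cover])

lemma theta_sec:
  assumes "coord_prod y \<noteq> 0" "\<alpha> ^ 3 * y$1 = y$3" "\<beta> ^ 3 * y$4 = y$5"
  shows "\<theta> (hpt (sec \<alpha> \<beta> y)) = hpt y"
  using sec_in_torus [OF assms] by (simp add: theta_hpt coord_prod_nonzeroD cover_sec assms hpt_scale)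

lemma sec_in_XT:
  assumes "coord_prod y \<noteq> 0" "\<alpha> ^ 3 * y$1 = y$3" "\<beta> ^ 3 * y$4 = y$5" "H y = 0"
  shows "hpt (sec \<alpha> \<beta> y) \<in> XT"
  using sec_in_torus [OF assms(1-3)] F_sec [OF assms(2,3)] assms(4)
    hpt_in_torus_part_iff [OF homogeneous_F] coord_prod_nonzeroD by metis

lemma XT_cases:
  assumes "p \<in> XT"
  obtains \<alpha> \<beta> y where "coord_prod y \<noteq> 0" "\<alpha> ^ 3 * y$1 = y$3" "\<beta> ^ 3 * y$4 = y$5" "H y = 0"
    "p = hpt (sec \<alpha> \<beta> y)"
proof -
  obtain x where x: "p = hpt x" "F x = 0" "coord_prod x \<noteq> 0"
    by (rule torus_part_cases [OF homogeneous_F assms])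
  obtain \<alpha> \<beta> y where "coord_prod y \<noteq> 0" "\<alpha> ^ 3 * y$1 = y$3" "\<beta> ^ 3 * y$4 = y$5" "x = sec \<alpha> \<beta> y"
    using torus_is_sec [OF x(3)] by blast
  then show ?thesis
    using that x F_sec by metis
qed

lemma theta_image: "\<theta> ` XT = YT"
proof (intro equalityI subsetI)
  fix q assume "q \<in> \<theta> ` XT"
  then obtain p where "p \<in> XT" "q = \<theta> p" by blast
  then obtain \<alpha> \<beta> y where "coord_prod y \<noteq> 0" "H y = 0" "q = hpt y"
    using theta_sec by (metis XT_cases)
  then show "q \<in> YT"
    using hpt_in_torus_part_iff [OF homogeneous_H coord_prod_nonzeroD] by blast
next
  fix q assume "q \<in> YT"
  then obtain y where y: "q = hpt y" "H y = 0" "coord_prod y \<noteq> 0"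
    by (rule torus_part_cases [OF homogeneous_H])
  obtain \<alpha> \<beta> where ab: "\<alpha> ^ 3 * y$1 = y$3" "\<beta> ^ 3 * y$4 = y$5"
    using ex_sec [OF y(3)] .
  show "q \<in> \<theta> ` XT"
    using theta_sec [OF y(3) ab] sec_in_XT [OF y(3) ab y(2)] y(1) by (metis imageI)
qed

text \<open>A point lies in its own orbit, hence is a rotation of \<open>p'\<close>; rotations
  change neither \<open>coord_prod\<close> nor \<open>cover\<close>.\<close>

lemma orbit_eq_imp:
  assumes "p \<in> X" "p' \<in> XT" "orbit_of (G12 \<xi>) p = orbit_of (G12 \<xi>) p'"
  shows "p \<in> XT \<and> \<theta> p = \<theta> p'"
proof -
  obtain x where x: "x \<noteq> 0" "p = hpt x"
    using assms(1) zero_locus_subset projective_space_cases by blast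
  obtain x' where x': "p' = hpt x'" "coord_prod x' \<noteq> 0"
    using torus_part_cases [OF homogeneous_F assms(2)] by blast
  have "p \<in> orbit_of (G12 \<xi>) p"
    unfolding x(2) orbit_of_G12
    by (intro CollectI exI [of _ 1]) (simp add: rot_1)
  then obtain w e where we: "w ^ 3 = 1" "e ^ 3 = 1" "p = hpt (rot w e *v x')"
    unfolding assms(3) x'(1) orbit_of_G12 by blast
  have "coord_prod (rot w e *v x') \<noteq> 0"
    using x'(2) we by (simp add: coord_prod_rot)
  moreover note nz = coord_prod_nonzeroD [OF this]
  ultimately have "p \<in> XT"
    using assms(1) we(3) hpt_in_hypersurface_iff [OF homogeneous_F nz]
      hpt_in_torus_part_iff [OF homogeneous_F nz] by simp
  then show ?thesis
    using nz we by (simp add: x'(1) theta_hpt cover_rot coord_prod_nonzeroD [OF x'(2)])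
qed

text \<open>After rescaling, both points lie over the same \<open>y'\<close> and differ only in the
  choice of cube roots; the ratios \<open>w\<close> and \<open>e\<close> of these choices are cube
  roots of unity.\<close>

lemma theta_eq_imp:
  assumes "p \<in> XT" "p' \<in> XT" "\<theta> p = \<theta> p'"
  shows "orbit_of (G12 \<xi>) p = orbit_of (G12 \<xi>) p'"
proof -
  obtain \<alpha> \<beta> y where y: "coord_prod y \<noteq> 0" "\<alpha> ^ 3 * y$1 = y$3" "\<beta> ^ 3 * y$4 = y$5"
      "p = hpt (sec \<alpha> \<beta> y)"
    using XT_cases [OF assms(1)] by metis
  obtain \<alpha>' \<beta>' y' where y': "coord_prod y' \<noteq> 0" "\<alpha>' ^ 3 * y'$1 = y'$3" "\<beta>' ^ 3 * y'$4 = y'$5"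
      "p' = hpt (sec \<alpha>' \<beta>' y')"
    using XT_cases [OF assms(2)] by metis
  have "hpt y = hpt y'"
    using assms(3) theta_sec y y' by simp
  then obtain k where k: "k \<noteq> 0" "y = k *s y'"
    using hpt_eqD coord_prod_nonzeroD y(1) by blast
  define w e where "w = \<alpha> / \<alpha>'" and "e = \<beta> / \<beta>'"
  have nz: "\<alpha>' \<noteq> 0" "\<beta>' \<noteq> 0" "y'$1 \<noteq> 0" "y'$4 \<noteq> 0"
    using y' by (auto simp: coord_prod_nonzero)
  have "\<alpha> ^ 3 * y'$1 = \<alpha>' ^ 3 * y'$1" "\<beta> ^ 3 * y'$4 = \<beta>' ^ 3 * y'$4"
    using y(2,3) y'(2,3) k by auto
  then have "w ^ 3 = 1" "e ^ 3 = 1"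
    using nz by (auto simp: w_def e_def power_divide)
  moreover have "sec \<alpha> \<beta> y' = rot w e *v sec \<alpha>' \<beta>' y'"
    using nz by (simp add: rot_vec sec_def vec_eq_5 w_def e_def power_divide)
  moreover have "p = hpt (sec \<alpha> \<beta> y')"
    unfolding y(4) k(2) sec_scale by (rule hpt_scale [OF k(1)])
  ultimately show ?thesis
    using orbit_of_G12_rot y'(4) by simp
qed

lemma theta_maps:
  assumes "x \<noteq> 0" "hpt x \<in> XT"
  shows "cover x \<noteq> 0 \<and> hpt (cover x) \<in> Y"
proof -
  have "coord_prod x \<noteq> 0"
    using hpt_in_torus_part_iff [OF homogeneous_F assms(1)] assms(2) by blast
  moreover have "hpt (cover x) \<in> YT"
    using assms theta_image theta_hpt by blast
  ultimately show ?thesis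
    using coord_prod_cover coord_prod_nonzeroD unfolding torus_part_def by blast
qed

lemma coefficients_eq_0:
  assumes y: "coord_prod y \<noteq> 0"
    and 0: "\<And>\<alpha> \<beta>. \<alpha> ^ 3 * y$1 = y$3 \<Longrightarrow> \<beta> ^ 3 * y$4 = y$5 \<Longrightarrow>
      (\<Sum>i<3. \<Sum>j<3. c i j * \<alpha> ^ i * \<beta> ^ j) = 0"
    and ij: "i < 3" "j < 3"
  shows "c i j = 0"
proof (rule biquadratic_eq_0 [OF _ _ _ ij])
  show "y$3 / y$1 \<noteq> 0" "y$5 / y$4 \<noteq> 0"
    using y by (auto simp: coord_prod_nonzero)
  show "(\<Sum>i<3. \<Sum>j<3. c i j * \<alpha> ^ i * \<beta> ^ j) = 0"
    if "\<alpha> ^ 3 = y$3 / y$1" "\<beta> ^ 3 = y$5 / y$4" for \<alpha> \<beta>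
    using y that by (intro 0) (auto simp: coord_prod_nonzero)
qed

text \<open>For the descent, a form is nonzero somewhere on the fibre over \<open>y\<close> exactly
  when one of its nine coefficients is nonzero at \<open>y\<close>. The coefficients are therefore
  the defining forms on the target.\<close>

lemma openin_theta_iff:
  assumes W: "W \<subseteq> YT"
  shows "openin (topo (proj_variety Y)) W \<longleftrightarrow>
    openin (topo (proj_variety X)) {p \<in> XT. \<theta> p \<in> W}"
proof
  show "openin (topo (proj_variety X)) {p \<in> XT. \<theta> p \<in> W}" if "openin (topo (proj_variety Y)) W"
    by (rule openin_proj_map_preimage [OF homogeneous_cover zero_locus_subset zero_locus_subset
          openin_torus_part [OF homogeneous_F] theta_maps that])
next
  assume O: "openin (topo (proj_variety X)) {p \<in> XT. \<theta> p \<in> W}"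
  obtain S where S1: "\<forall>f\<in>S. \<exists>d. homogeneous d f" and
      S2: "\<forall>x. x \<noteq> 0 \<longrightarrow> (hpt x \<in> {p \<in> XT. \<theta> p \<in> W} \<longleftrightarrow> hpt x \<in> X \<and> (\<exists>f\<in>S. f x \<noteq> 0))"
    by (rule openin_proj_varietyE [OF O zero_locus_subset])
  note S = S1 S2 [rule_format, unfolded mem_Collect_eq]
  have "\<forall>f\<in>S. \<exists>P d. sec_coeffs d f P"
    using S(1) ex_sec_coeffs by blast
  then obtain P where P: "\<forall>f\<in>S. \<exists>d. sec_coeffs d f (P f)"
    by (rule bchoice [THEN exE])
  \<comment> \<open>The factor \<open>coord_prod\<close> excludes points outside the torus, where
    the fibre expansion does not decide membership in \<open>W\<close>.\<close>
  define R where "R = (\<lambda>(f, i, j) y. coord_prod y * P f i j y) ` (S \<times> {..<3} \<times> {..<3})"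
  have hom: "\<exists>d. homogeneous d g" if "g \<in> R" for g
  proof -
    obtain f i j where g: "g = (\<lambda>y. coord_prod y * P f i j y)" "f \<in> S"
      using \<open>g \<in> R\<close> unfolding R_def by auto
    then obtain e where "homogeneous e (P f i j)"
      using P unfolding sec_coeffs_def by blast
    then show ?thesis
      unfolding g(1) using homogeneous_mult [OF homogeneous_coord_prod] by blast
  qed
  have "hpt y \<in> W \<longleftrightarrow> hpt y \<in> Y \<and> (\<exists>g\<in>R. g y \<noteq> 0)" if "y \<noteq> 0" for y
  proof (cases "coord_prod y \<noteq> 0 \<and> H y = 0")
    case False
    then show ?thesis
      using W hpt_in_torus_part_iff [OF homogeneous_H \<open>y \<noteq> 0\<close>]
        hpt_in_hypersurface_iff [OF homogeneous_H \<open>y \<noteq> 0\<close>] unfolding R_def by auto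
  next
    case True
    then have y: "coord_prod y \<noteq> 0" "H y = 0" by auto
    \<comment> \<open>The whole fibre has the same image under \<open>\<theta>\<close>, so this
      equivalence holds for every choice of \<open>\<alpha>\<close> and \<open>\<beta>\<close>. If
      \<open>hpt y\<close> is not in \<open>W\<close>, all forms in \<open>S\<close> thus vanish on
      the entire fibre.\<close>
    have sec: "hpt y \<in> W \<longleftrightarrow> (\<exists>f\<in>S. f (sec \<alpha> \<beta> y) \<noteq> 0)"
      if ab: "\<alpha> ^ 3 * y$1 = y$3" "\<beta> ^ 3 * y$4 = y$5" for \<alpha> \<beta>
      using S(2) [OF coord_prod_nonzeroD [OF sec_in_torus [OF y(1) ab]]]
        sec_in_XT [OF y(1) ab y(2)] theta_sec [OF y(1) ab] unfolding torus_part_def by auto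
    have "hpt y \<in> W \<longleftrightarrow> (\<exists>f\<in>S. \<exists>i<3. \<exists>j<3. P f i j y \<noteq> 0)"
    proof
      assume "hpt y \<in> W"
      obtain \<alpha> \<beta> where ab: "\<alpha> ^ 3 * y$1 = y$3" "\<beta> ^ 3 * y$4 = y$5"
        using ex_sec [OF y(1)] .
      then obtain f where "f \<in> S" "f (sec \<alpha> \<beta> y) \<noteq> 0"
        using sec \<open>hpt y \<in> W\<close> by blast
      then have "(\<Sum>i<3. \<Sum>j<3. P f i j y * \<alpha> ^ i * \<beta> ^ j) \<noteq> 0"
        using P ab unfolding sec_coeffs_def by auto
      then obtain i j where "i < 3" "j < 3" "P f i j y * \<alpha> ^ i * \<beta> ^ j \<noteq> 0"
        by (metis (no_types, lifting) lessThan_iff sum.neutral)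
      then show "\<exists>f\<in>S. \<exists>i<3. \<exists>j<3. P f i j y \<noteq> 0"
        using \<open>f \<in> S\<close> by (metis mult_zero_left)
    next
      assume "\<exists>f\<in>S. \<exists>i<3. \<exists>j<3. P f i j y \<noteq> 0"
      then obtain f i j where f: "f \<in> S" "i < 3" "j < 3" "P f i j y \<noteq> 0" by blast
      show "hpt y \<in> W"
      proof (rule ccontr)
        assume "hpt y \<notin> W"
        have "P f i j y = 0"
          by (rule coefficients_eq_0 [where c = "\<lambda>i j. P f i j y", OF y(1) _ f(2,3)])
            (use P f(1) sec \<open>hpt y \<notin> W\<close> in \<open>auto simp: sec_coeffs_def\<close>)
        with f(4) show False by simp
      qed
    qed
    also have "\<dots> \<longleftrightarrow> (\<exists>g\<in>R. g y \<noteq> 0)"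
      unfolding R_def using y(1) by auto
    finally show ?thesis
      using y(2) hpt_in_hypersurface_iff [OF homogeneous_H \<open>y \<noteq> 0\<close>] by simp
  qed
  with W hom show "openin (topo (proj_variety Y)) W"
    unfolding openin_proj_variety_iff [OF zero_locus_subset] torus_part_def by blast
qed

text \<open>
  A \<open>G\<close>-invariant local fraction \<open>g / h\<close> is only given near one point of the fibre. Multiplying
  both \<open>g\<close> and \<open>h\<close> by a form \<open>s\<close> that vanishes off its domain makes \<open>h s f = g s\<close> valid on the whole
  saturated open set, where the coefficients of both sides can be compared.
\<close>

lemma reg_theta_descend:
  assumes W: "W \<subseteq> YT" "openin (topo (proj_variety Y)) W"
    and reg: "reg (proj_variety X) {p \<in> XT. \<theta> p \<in> W} (f \<circ> \<theta>)"
  shows "reg (proj_variety Y) W f"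
  unfolding reg_proj_variety_iff
proof
  fix q assume q: "q \<in> W"
  then obtain y where y: "q = hpt y" "H y = 0" "coord_prod y \<noteq> 0"
    using torus_part_cases [OF homogeneous_H] W(1) by blast
  obtain \<alpha> \<beta> where ab: "\<alpha> ^ 3 * y$1 = y$3" "\<beta> ^ 3 * y$4 = y$5"
    using ex_sec [OF y(3)] .
  define x where "x = sec \<alpha> \<beta> y"
  have x: "x \<noteq> 0" "hpt x \<in> XT" "\<theta> (hpt x) = q"
    unfolding x_def y(1) using coord_prod_nonzeroD sec_in_torus sec_in_XT theta_sec y ab by blast+
  then have "hpt x \<in> {p \<in> XT. \<theta> p \<in> W}"
    using q by simp
  then obtain V m g h where V: "openin (topo (proj_variety X)) V" "hpt x \<in> V"
      "V \<subseteq> {p \<in> XT. \<theta> p \<in> W}" "homogeneous m g" "homogeneous m h"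
      "\<forall>z. z \<noteq> 0 \<longrightarrow> hpt z \<in> V \<longrightarrow> h z \<noteq> 0 \<and> (f \<circ> \<theta>) (hpt z) = g z / h z"
    by (rule reg_proj_varietyE [OF reg])
  obtain S where S: "\<forall>f\<in>S. \<exists>d. homogeneous d f"
      "\<forall>z. z \<noteq> 0 \<longrightarrow> (hpt z \<in> V \<longleftrightarrow> hpt z \<in> X \<and> (\<exists>f\<in>S. f z \<noteq> 0))"
    by (rule openin_proj_varietyE [OF V(1) zero_locus_subset])
  obtain s n where s: "s \<in> S" "s x \<noteq> 0" "homogeneous n s"
    using S V(2) x(1) by blast
  define g' h' where "g' z = g z * s z" and "h' z = h z * s z" for z
  have "homogeneous (m + n) g'" "homogeneous (m + n) h'"
    unfolding g'_def h'_def by (intro homogeneous_mult V s)+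
  then obtain P Q where PQ: "sec_coeffs (m + n) g' P" "sec_coeffs (m + n) h' Q"
    using ex_sec_coeffs by blast
  note P = PQ(1) [unfolded sec_coeffs_def, THEN conjunct1, rule_format]
    PQ(1) [unfolded sec_coeffs_def, THEN conjunct2, rule_format]
  note Q = PQ(2) [unfolded sec_coeffs_def, THEN conjunct1, rule_format]
    PQ(2) [unfolded sec_coeffs_def, THEN conjunct2, rule_format]
  have "h' x \<noteq> 0"
    using s(2) V(2,6) x(1) by (simp add: h'_def)
  \<comment> \<open>Nonvanishing at a single point of the fibre forces one coefficient to be nonzero
    at \<open>y\<close>; it becomes the denominator downstairs.\<close>
  then obtain i j where ij: "i < 3" "j < 3" "Q i j y \<noteq> 0"
    unfolding x_def Q(2) [OF ab]
    by (metis (no_types, lifting) lessThan_iff sum.neutral mult_zero_left)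
  \<comment> \<open>The value \<open>f (hpt z)\<close> is constant along the fibre, so
    \<open>g' = f h'\<close> is an identity between polynomials in the cube roots, and the
    coefficients at \<open>i\<close>, \<open>j\<close> agree.\<close>
  have PQ_eq: "P i j z = f (hpt z) * Q i j z" if "z \<noteq> 0" "hpt z \<in> W" for z
  proof -
    have z: "H z = 0" "coord_prod z \<noteq> 0"
      using that W(1) hpt_in_torus_part_iff [OF homogeneous_H \<open>z \<noteq> 0\<close>] by blast+
    have "P i j z - f (hpt z) * Q i j z = 0"
    proof (rule coefficients_eq_0 [where c = "\<lambda>i j. P i j z - f (hpt z) * Q i j z", OF z(2) _ ij(1,2)])
      fix \<gamma> \<delta> assume cd: "\<gamma> ^ 3 * z$1 = z$3" "\<delta> ^ 3 * z$4 = z$5"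
      define u where "u = sec \<gamma> \<delta> z"
      have u: "u \<noteq> 0" "hpt u \<in> XT" "\<theta> (hpt u) = hpt z"
        unfolding u_def using coord_prod_nonzeroD sec_in_torus sec_in_XT theta_sec z cd by blast+
      have "g' u = f (hpt z) * h' u"
      proof (cases "hpt u \<in> V")
        case True
        then have "h u \<noteq> 0 \<and> f (hpt z) = g u / h u"
          using V(6) u(1,3) by (metis comp_apply)
        then show ?thesis
          by (simp add: g'_def h'_def)
      next
        case False
        then have "s u = 0"
          using S(2) u(1) False s(1) u(2) unfolding torus_part_def by blast
        then show ?thesis
          by (simp add: g'_def h'_def)
      qed
      then show "(\<Sum>i<3. \<Sum>j<3. (P i j z - f (hpt z) * Q i j z) * \<gamma> ^ i * \<delta> ^ j) = 0"
        unfolding u_def P(2) [OF cd] Q(2) [OF cd]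
        by (simp add: left_diff_distrib sum_subtractf sum_distrib_left mult.assoc)
    qed
    then show ?thesis by simp
  qed
  obtain R where R: "\<forall>f\<in>R. \<exists>d. homogeneous d f"
      "\<forall>z. z \<noteq> 0 \<longrightarrow> (hpt z \<in> W \<longleftrightarrow> hpt z \<in> Y \<and> (\<exists>f\<in>R. f z \<noteq> 0))"
    by (rule openin_proj_varietyE [OF W(2) zero_locus_subset])
  define W' where "W' = W - zero_locus {Q i j}"
  have W': "hpt z \<in> W' \<longleftrightarrow> hpt z \<in> W \<and> Q i j z \<noteq> 0" if "z \<noteq> 0" for z
    unfolding W'_def using hpt_in_hypersurface_iff [OF Q(1) that] by auto
  have "openin (topo (proj_variety Y)) W'"
    unfolding openin_proj_variety_iff [OF zero_locus_subset]
  proof (intro conjI exI [of _ "(\<lambda>r z. r z * Q i j z) ` R"] ballI allI impI)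
    show "W' \<subseteq> Y"
      using W(1) unfolding W'_def torus_part_def by blast
    show "\<exists>d. homogeneous d r" if r: "r \<in> (\<lambda>r z. r z * Q i j z) ` R" for r
    proof -
      obtain r' e where "r' \<in> R" "r = (\<lambda>z. r' z * Q i j z)" "homogeneous e r'"
        using r R(1) by blast
      then show ?thesis using homogeneous_mult [OF _ Q(1)] by blast
    qed
    show "hpt z \<in> W' \<longleftrightarrow> hpt z \<in> Y \<and> (\<exists>r\<in>(\<lambda>r z. r z * Q i j z) ` R. r z \<noteq> 0)" if "z \<noteq> 0" for z
      using W' [OF that] R(2) that by auto
  qed
  moreover have "q \<in> W'"
    using q ij(3) W' [OF coord_prod_nonzeroD [OF y(3)]] y(1) by simp
  moreover have "\<forall>z. z \<noteq> 0 \<and> hpt z \<in> W' \<longrightarrow> Q i j z \<noteq> 0 \<and> f (hpt z) = P i j z / Q i j z"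
    using PQ_eq W' by auto
  moreover have "W' \<subseteq> W"
    unfolding W'_def by blast
  ultimately show "\<exists>V d g h. openin (topo (proj_variety Y)) V \<and> q \<in> V \<and> V \<subseteq> W \<and>
      homogeneous d g \<and> homogeneous d h \<and>
      (\<forall>z. z \<noteq> 0 \<and> hpt z \<in> V \<longrightarrow> h z \<noteq> 0 \<and> f (hpt z) = g z / h z)"
    using P(1) Q(1)
    by (intro exI [of _ W'] exI [of _ "m + n"] exI [of _ "P i j"] exI [of _ "Q i j"] conjI)
qed

lemma reg_theta_iff:
  assumes W: "W \<subseteq> YT" "openin (topo (proj_variety Y)) W"
  shows "reg (proj_variety Y) W f \<longleftrightarrow> reg (proj_variety X) {p \<in> XT. \<theta> p \<in> W} (f \<circ> \<theta>)"
  using reg_theta_descend [OF W] reg_proj_map_pullback [OF homogeneous_cover zero_locus_subset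
      zero_locus_subset openin_torus_part [OF homogeneous_F] theta_maps] by blast

lemma dense_torus_part:
  assumes "homogeneous d K"
    and dense: "\<And>e s x. homogeneous e s \<Longrightarrow> K x = 0 \<Longrightarrow> s x \<noteq> 0 \<Longrightarrow>
      \<exists>y. K y = 0 \<and> s y \<noteq> 0 \<and> coord_prod y \<noteq> 0"
  shows "Abstract_Topology.closure_of (topo (proj_variety (hypersurface K))) (torus_part K) =
     topspace (topo (proj_variety (hypersurface K)))"
proof (rule dense_in_proj_variety [OF zero_locus_subset])
  show "torus_part K \<subseteq> hypersurface K"
    unfolding torus_part_def by blast
  show "\<exists>y. y \<noteq> 0 \<and> hpt y \<in> torus_part K \<and> s y \<noteq> 0"
    if "homogeneous e s" "x \<noteq> 0" "hpt x \<in> hypersurface K" "s x \<noteq> 0" for e s x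
    using dense [OF that(1) _ that(4)] that(2,3) hpt_in_hypersurface_iff [OF assms(1)]
      hpt_in_torus_part_iff [OF assms(1)] coord_prod_nonzeroD by metis
qed

lemma birational_quotient: "birational (quotient_variety X (G12 \<xi>)) (proj_variety Y)"
proof -
  have XT: "XT \<subseteq> X"
    unfolding torus_part_def by blast
  note ident = quotient_variety_identification [where \<theta> = \<theta>, OF zero_locus_subset XT orbit_eq_imp theta_eq_imp
      theta_image openin_torus_part [OF homogeneous_H] openin_theta_iff reg_theta_iff]
  note dense = dense_in_quotient_variety [OF dense_torus_part [OF homogeneous_F dense_F]]
    dense_torus_part [OF homogeneous_H dense_H]
  show ?thesis
    unfolding birational_def
    by (intro exI [of _ "orbit_of (G12 \<xi>) ` XT"] exI [of _ YT] conjI ident dense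
        openin_torus_part [OF homogeneous_H])
qed

end

section \<open>The cubic forms\<close>

text \<open>The value at \<open>z\<close> is, in norm, \<open>norm t\<close> times the product of
  the distances from \<open>z\<close> to the three roots, so the nearest root satisfies the bound.
  The missing quadratic term matches both cubics as polynomials in \<open>x $ 2\<close>.\<close>

lemma cubic_root_near:
  fixes t b c z :: complex
  assumes "t \<noteq> 0"
  obtains r where "t * r ^ 3 + b * r + c = 0" "norm t * norm (r - z) ^ 3 \<le> norm (t * z ^ 3 + b * z + c)"
proof -
  have "degree [:c, b, 0, t:] = 3"
    using assms by simp
  then obtain r1 where "poly [:c, b, 0, t:] r1 = 0"
    using alg_closed_imp_poly_has_root [of "[:c, b, 0, t:]"] by auto
  then have r1: "t * r1 ^ 3 + b * r1 + c = 0"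
    by (simp add: algebra_simps power3_eq_cube)
  \<comment> \<open>A square root of the discriminant of w^2 + r1 w + (r1^2 + b/t), the quotient of
    the monic cubic by w - r1.\<close>
  define D where "D = csqrt (r1\<^sup>2 - 4 * (r1\<^sup>2 + b / t))"
  have D: "D\<^sup>2 * t = (r1\<^sup>2 - 4 * r1\<^sup>2) * t - 4 * b"
    unfolding D_def power2_csqrt using assms by (simp add: field_simps)
  define r2 r3 where "r2 = (- r1 + D) / 2" and "r3 = (- r1 - D) / 2"
  have r23: "2 * r2 = - r1 + D" "2 * r3 = - r1 - D"
    by (simp_all add: r2_def r3_def)
  have factor: "t * w ^ 3 + b * w + c = t * ((w - r1) * (w - r2) * (w - r3))" for w
  proof -
    have "4 * (t * w ^ 3 + b * w + c) = t * (w - r1) * (2 * w - 2 * r2) * (2 * w - 2 * r3)"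
      unfolding r23 using r1 D by algebra
    also have "\<dots> = 4 * (t * ((w - r1) * (w - r2) * (w - r3)))"
      by algebra
    finally show ?thesis by (simp only: mult_cancel_left) simp
  qed
  have norm: "norm (t * z ^ 3 + b * z + c) = norm t * (norm (r1 - z) * norm (r2 - z) * norm (r3 - z))"
    unfolding factor norm_mult by (simp add: norm_minus_commute)
  define m where "m = Min {norm (r1 - z), norm (r2 - z), norm (r3 - z)}"
  have "m \<in> {norm (r1 - z), norm (r2 - z), norm (r3 - z)}"
    unfolding m_def by (rule Min_in) auto
  then obtain r where r: "r \<in> {r1, r2, r3}" "m = norm (r - z)"
    by auto
  have m: "0 \<le> m" "m \<le> norm (r1 - z)" "m \<le> norm (r2 - z)" "m \<le> norm (r3 - z)"
    by (simp_all add: m_def)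
  have "m * m * m \<le> norm (r1 - z) * norm (r2 - z) * norm (r3 - z)"
    using m by (intro mult_mono) auto
  then have "norm t * norm (r - z) ^ 3 \<le> norm (t * z ^ 3 + b * z + c)"
    unfolding norm r(2) [symmetric] unfolding power3_eq_cube by (intro mult_left_mono) auto
  moreover have "t * r ^ 3 + b * r + c = 0"
    unfolding factor using r(1) by auto
  ultimately show ?thesis by (rule that [rotated])
qed

text \<open>
  Perturb the other four coordinates of a zero off the coordinate hyperplanes and solve the
  cubic equation for \<open>x $ 2\<close>: one of its roots stays close.
\<close>

lemma coord_prod_dense:
  fixes K s :: "complex ^ 5 \<Rightarrow> complex"
  assumes t: "t \<noteq> 0"
    and K: "\<And>x. K x = t * (x$2) ^ 3 + B (x$1) (x$3) (x$4) (x$5) * x$2 + C (x$1) (x$3) (x$4) (x$5)"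
    and cont: "continuous_on UNIV K" "continuous_on UNIV s"
    and x: "K x = 0" "s x \<noteq> 0"
  shows "\<exists>y. K y = 0 \<and> s y \<noteq> 0 \<and> coord_prod y \<noteq> 0"
proof -
  define \<epsilon> where "\<epsilon> n = complex_of_real (inverse (real (Suc n)))" for n
  have \<epsilon>: "\<epsilon> \<longlonglongrightarrow> 0" "\<epsilon> n \<noteq> 0" for n
    using tendsto_of_real [OF LIMSEQ_inverse_real_of_nat, where ?'a = complex]
    by (simp_all add: \<epsilon>_def [abs_def] del: of_nat_Suc)
  define v where "v n z = (vector [x$1 + \<epsilon> n, z, x$3 + \<epsilon> n, x$4 + \<epsilon> n, x$5 + \<epsilon> n] :: complex ^ 5)" for n z
  have "\<exists>r. K (v n r) = 0 \<and> norm t * norm (r - x$2) ^ 3 \<le> norm (K (v n (x$2)))" for n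
    using cubic_root_near [OF t, of "B (x$1 + \<epsilon> n) (x$3 + \<epsilon> n) (x$4 + \<epsilon> n) (x$5 + \<epsilon> n)"
        "C (x$1 + \<epsilon> n) (x$3 + \<epsilon> n) (x$4 + \<epsilon> n) (x$5 + \<epsilon> n)" "x$2"]
    unfolding K v_def vector_5 by metis
  then obtain r where r: "\<And>n. K (v n (r n)) = 0"
      "\<And>n. norm t * norm (r n - x$2) ^ 3 \<le> norm (K (v n (x$2)))"
    by metis
  have v: "(\<lambda>n. v n (z n)) \<longlonglongrightarrow> x" if "z \<longlonglongrightarrow> x$2" for z
  proof (rule vec_tendstoI)
    have \<epsilon>': "(\<lambda>n. a + \<epsilon> n) \<longlonglongrightarrow> a" for a
      using tendsto_add [OF tendsto_const \<epsilon>(1), of a] by simp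
    have "\<forall>i. (\<lambda>n. v n (z n) $ i) \<longlonglongrightarrow> x $ i"
      unfolding forall_5 v_def vector_5 using \<epsilon>' that by blast
    then show "(\<lambda>n. v n (z n) $ i) \<longlonglongrightarrow> x $ i" for i ..
  qed
  have lim: "(\<lambda>n. f (v n (z n))) \<longlonglongrightarrow> f x" if "continuous_on UNIV f" "z \<longlonglongrightarrow> x$2"
    for f :: "complex ^ 5 \<Rightarrow> complex" and z
    by (rule continuous_on_tendsto_compose [OF that(1) v [OF that(2)]]) auto
  have "(\<lambda>n. K (v n (x$2))) \<longlonglongrightarrow> 0"
    using lim [OF cont(1) tendsto_const] x(1) by simp
  \<comment> \<open>The bound from \<open>cubic_root_near\<close> tends to 0 with the cubic at the
    perturbed point, because \<open>x $ 2\<close> solves the unperturbed equation.\<close>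
  then have "(\<lambda>n. root 3 (norm (K (v n (x$2))) / norm t)) \<longlonglongrightarrow> root 3 (norm (0::complex) / norm t)"
    using t by (intro tendsto_intros) auto
  then have root_lim: "(\<lambda>n. root 3 (norm (K (v n (x$2))) / norm t)) \<longlonglongrightarrow> 0"
    by simp
  have root_le: "norm (r n - x$2) \<le> root 3 (norm (K (v n (x$2))) / norm t)" for n
  proof -
    have "norm (r n - x$2) ^ 3 \<le> norm (K (v n (x$2))) / norm t"
      using r(2) [of n] t by (simp add: field_simps)
    then have "root 3 (norm (r n - x$2) ^ 3) \<le> root 3 (norm (K (v n (x$2))) / norm t)"
      by simp
    then show ?thesis
      by (simp add: real_root_power_cancel)
  qed
  have "(\<lambda>n. r n - x$2) \<longlonglongrightarrow> 0"
    by (rule Lim_null_comparison [OF always_eventually [OF allI [OF root_le]] root_lim])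
  then have r_lim: "r \<longlonglongrightarrow> x$2"
    by (rule LIM_zero_cancel)
  have "(\<lambda>n. s (v n (r n))) \<longlonglongrightarrow> s x"
    by (rule lim [OF cont(2) r_lim])
  then have s: "\<forall>\<^sub>F n in sequentially. s (v n (r n)) \<noteq> 0"
    using x(2) by (rule tendsto_imp_eventually_ne)
  \<comment> \<open>If \<open>a\<close> is zero, the perturbation itself is nonzero; otherwise the
    limit is.\<close>
  have nz: "\<forall>\<^sub>F n in sequentially. a + \<epsilon> n \<noteq> 0" for a
  proof (cases "a = 0")
    case False
    have "(\<lambda>n. a + \<epsilon> n) \<longlonglongrightarrow> a"
      using tendsto_add [OF tendsto_const \<epsilon>(1), of a] by simp
    then show ?thesis using False by (rule tendsto_imp_eventually_ne)
  qed (simp add: \<epsilon>(2))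
  have "\<forall>\<^sub>F n in sequentially. s (v n (r n)) \<noteq> 0 \<and> coord_prod (v n (r n)) \<noteq> 0"
    using s nz [of "x$1"] nz [of "x$3"] nz [of "x$4"] nz [of "x$5"]
    by eventually_elim (simp add: coord_prod_nonzero v_def)
  then obtain n where "s (v n (r n)) \<noteq> 0 \<and> coord_prod (v n (r n)) \<noteq> 0"
    using eventually_happens' [OF sequentially_bot] by blast
  then show ?thesis using r(1) by blast
qed

lemma homogeneous_cubic_monomials:
  "homogeneous 3 (\<lambda>x. t * (x$i) ^ 3)"
  "homogeneous 3 (\<lambda>x. t * x$i * x$j * x$k)"
  "homogeneous 3 (\<lambda>x. t * (x$i)\<^sup>2 * x$j)"
  "homogeneous 3 (\<lambda>x. t * x$i * (x$j)\<^sup>2)"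
proof -
  have "homogeneous (3 * 1) (\<lambda>x. t * (x$i) ^ 3)" "homogeneous ((1 + 1) + 1) (\<lambda>x. t * x$i * x$j * x$k)"
    "homogeneous (2 * 1 + 1) (\<lambda>x. t * (x$i)\<^sup>2 * x$j)" "homogeneous (1 + 2 * 1) (\<lambda>x. t * x$i * (x$j)\<^sup>2)"
    by (intro homogeneous_intros)+
  then show "homogeneous 3 (\<lambda>x. t * (x$i) ^ 3)"
    "homogeneous 3 (\<lambda>x. t * x$i * x$j * x$k)"
    "homogeneous 3 (\<lambda>x. t * (x$i)\<^sup>2 * x$j)"
    "homogeneous 3 (\<lambda>x. t * x$i * (x$j)\<^sup>2)"
    by (simp_all add: numeral_3_eq_3)
qed

lemma homogeneous_cubic_X: "homogeneous 3 (cubic_X t1 t2 t3 t4 t5 t6 t7)"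
  unfolding cubic_X_def by (intro homogeneous_add homogeneous_cubic_monomials)

lemma homogeneous_cubic_Y: "homogeneous 3 (cubic_Y t1 t2 t3 t4 t5 t6 t7)"
  unfolding cubic_Y_def by (intro homogeneous_add homogeneous_cubic_monomials)

lemma cubic_X_sec:
  assumes "\<alpha> ^ 3 * y$1 = y$3" "\<beta> ^ 3 * y$4 = y$5"
  shows "cubic_X t1 t2 t3 t4 t5 t6 t7 (sec \<alpha> \<beta> y) = cubic_Y t1 t2 t3 t4 t5 t6 t7 y"
  unfolding cubic_X_def cubic_Y_def sec_def vector_5 assms [symmetric] by algebra

lemma birational_quotient_cubic:
  assumes "primitive_root_of_unity 3 \<xi>" "t2 \<noteq> 0"
  shows "birational (quotient_variety (hypersurface (cubic_X t1 t2 t3 t4 t5 t6 t7)) (G12 \<xi>))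
     (proj_variety (hypersurface (cubic_Y t1 t2 t3 t4 t5 t6 t7)))"
proof -
  interpret cyclic_cover \<xi> "cubic_X t1 t2 t3 t4 t5 t6 t7" "cubic_Y t1 t2 t3 t4 t5 t6 t7" 3
  proof (unfold_locales; (intro assms homogeneous_cubic_X homogeneous_cubic_Y cubic_X_sec; assumption)?)
    fix e s and x :: "complex ^ 5"
    assume s: "homogeneous e s" "s x \<noteq> 0"
    show "\<exists>y. cubic_X t1 t2 t3 t4 t5 t6 t7 y = 0 \<and> s y \<noteq> 0 \<and> coord_prod y \<noteq> 0"
      if "cubic_X t1 t2 t3 t4 t5 t6 t7 x = 0"
      \<comment> \<open>\<open>B\<close> is the coefficient of \<open>x $ 2\<close> and
        \<open>C\<close> the part free of it.\<close>
      by (rule coord_prod_dense [OF assms(2) _ continuous_on_homogeneous [OF homogeneous_cubic_X]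
            continuous_on_homogeneous [OF s(1)] that s(2),
            where B = "\<lambda>a b c d. t6 * a * b + t7 * c * d" and
              C = "\<lambda>a b c d. t1 * a ^ 3 + t3 * b ^ 3 + t4 * c ^ 3 + t5 * d ^ 3"])
        (simp add: cubic_X_def algebra_simps)
    show "\<exists>y. cubic_Y t1 t2 t3 t4 t5 t6 t7 y = 0 \<and> s y \<noteq> 0 \<and> coord_prod y \<noteq> 0"
      if "cubic_Y t1 t2 t3 t4 t5 t6 t7 x = 0"
      by (rule coord_prod_dense [OF assms(2) _ continuous_on_homogeneous [OF homogeneous_cubic_Y]
            continuous_on_homogeneous [OF s(1)] that s(2),
            where B = "\<lambda>a b c d. t6 * a * b + t7 * c * d" and
              C = "\<lambda>a b c d. t1 * a\<^sup>2 * b + t3 * a * b\<^sup>2 + t4 * c\<^sup>2 * d + t5 * c * d\<^sup>2"])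
        (simp add: cubic_Y_def algebra_simps)
  qed
  show ?thesis by (rule birational_quotient)
qed

section \<open>Smoothness of the target cubic\<close>

lemma partial_deriv_cubic_X:
  fixes x :: "complex ^ 5" and t1 t2 t3 t4 t5 t6 t7 :: complex
  defines "F \<equiv> cubic_X t1 t2 t3 t4 t5 t6 t7"
  shows "partial_deriv 1 F x = 3 * t1 * (x$1)\<^sup>2 + t6 * x$2 * x$3"
    and "partial_deriv 2 F x = 3 * t2 * (x$2)\<^sup>2 + t6 * x$1 * x$3 + t7 * x$4 * x$5"
    and "partial_deriv 3 F x = 3 * t3 * (x$3)\<^sup>2 + t6 * x$2 * x$1"
    and "partial_deriv 4 F x = 3 * t4 * (x$4)\<^sup>2 + t7 * x$2 * x$5"
    and "partial_deriv 5 F x = 3 * t5 * (x$5)\<^sup>2 + t7 * x$2 * x$4"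
  unfolding partial_deriv_def F_def cubic_X_def
  by (rule DERIV_imp_deriv, simp add: axis_def,
      (rule derivative_eq_intros refl | simp add: algebra_simps)+)+

lemma partial_deriv_cubic_Y:
  fixes y :: "complex ^ 5" and t1 t2 t3 t4 t5 t6 t7 :: complex
  defines "H \<equiv> cubic_Y t1 t2 t3 t4 t5 t6 t7"
  shows "partial_deriv 1 H y = y$3 * (2 * t1 * y$1 + t3 * y$3 + t6 * y$2)"
    and "partial_deriv 2 H y = 3 * t2 * (y$2)\<^sup>2 + t6 * y$1 * y$3 + t7 * y$4 * y$5"
    and "partial_deriv 3 H y = y$1 * (t1 * y$1 + 2 * t3 * y$3 + t6 * y$2)"
    and "partial_deriv 4 H y = y$5 * (2 * t4 * y$4 + t5 * y$5 + t7 * y$2)"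
    and "partial_deriv 5 H y = y$4 * (t4 * y$4 + 2 * t5 * y$5 + t7 * y$2)"
  unfolding partial_deriv_def H_def cubic_Y_def
  by (rule DERIV_imp_deriv, simp add: axis_def,
      (rule derivative_eq_intros refl | simp add: algebra_simps power2_eq_square)+)+

text \<open>The hypotheses say that the gradient of the binary cubic p q (a p + b q) vanishes; its
  three linear factors are distinct, so this happens only at the origin.\<close>

lemma singular_pair_eq_0:
  fixes a b p q :: complex
  assumes "a \<noteq> 0" "b \<noteq> 0" "q * (2 * a * p + b * q) = 0" "p * (a * p + 2 * b * q) = 0"
  shows "p = 0 \<and> q = 0"
proof -
  have "3 * (a * p ^ 3) = 0" "3 * (b * q ^ 3) = 0"
    using assms(3,4) by algebra+
  with assms(1,2) show ?thesis by simp
qed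

text \<open>Here \<open>(p, q)\<close> is one coordinate pair of a singular point of
  \<open>cubic_Y\<close> and \<open>v\<close> its second coordinate. The pair \<open>(u, w)\<close>
  satisfies the two corresponding derivative equations of \<open>cubic_X\<close>, and the equal
  product keeps the derivative in direction 2 unchanged.\<close>

lemma singular_pair_lift:
  fixes a b p q t v :: complex
  assumes 1: "q * (2 * a * p + b * q + t * v) = 0" and 2: "p * (a * p + 2 * b * q + t * v) = 0"
  obtains u w where "u * w = p * q" "3 * a * u\<^sup>2 + t * v * w = 0" "3 * b * w\<^sup>2 + t * v * u = 0"
proof (cases "p * q = 0")
  case True
  then show ?thesis by (intro that [of 0 0]) auto
next
  case False
  obtain \<alpha> where "\<alpha> ^ 3 = q / p"
    using ex_cube_root by blast
  with False have \<alpha>: "\<alpha> ^ 3 * p = q"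
    by auto
  have "2 * a * p + b * q + t * v = 0" "a * p + 2 * b * q + t * v = 0"
    using 1 2 False by auto
  \<comment> \<open>Twice one equation minus the other.\<close>
  then have e: "3 * a * p + t * v = 0" "3 * b * q + t * v = 0"
    by algebra+
  show ?thesis
  proof (rule that [of "\<alpha> * p" "\<alpha>\<^sup>2 * p"])
    show "\<alpha> * p * (\<alpha>\<^sup>2 * p) = p * q"
      unfolding \<alpha> [symmetric] by algebra
    have "3 * a * (\<alpha> * p)\<^sup>2 + t * v * (\<alpha>\<^sup>2 * p) = \<alpha>\<^sup>2 * p * (3 * a * p + t * v)"
      by algebra
    then show "3 * a * (\<alpha> * p)\<^sup>2 + t * v * (\<alpha>\<^sup>2 * p) = 0"
      unfolding e by simp
    have "3 * b * (\<alpha>\<^sup>2 * p)\<^sup>2 + t * v * (\<alpha> * p) = \<alpha> * p * (3 * b * q + t * v)"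
      unfolding \<alpha> [symmetric] by algebra
    then show "3 * b * (\<alpha>\<^sup>2 * p)\<^sup>2 + t * v * (\<alpha> * p) = 0"
      unfolding e by simp
  qed
qed

lemma smooth_cubic_Y:
  assumes t: "t1 \<noteq> 0" "t3 \<noteq> 0" "t4 \<noteq> 0" "t5 \<noteq> 0"
    and smooth: "smooth_hypersurface (cubic_X t1 t2 t3 t4 t5 t6 t7)"
  shows "smooth_hypersurface (cubic_Y t1 t2 t3 t4 t5 t6 t7)"
  unfolding smooth_hypersurface_def
proof (intro allI impI, rule ccontr)
  fix y :: "complex ^ 5"
  assume y: "y \<noteq> 0 \<and> cubic_Y t1 t2 t3 t4 t5 t6 t7 y = 0"
    and "\<nexists>i. partial_deriv i (cubic_Y t1 t2 t3 t4 t5 t6 t7) y \<noteq> 0"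
  then have "\<forall>i. partial_deriv i (cubic_Y t1 t2 t3 t4 t5 t6 t7) y = 0" by blast
  then have d: "y$3 * (2 * t1 * y$1 + t3 * y$3 + t6 * y$2) = 0"
      "y$1 * (t1 * y$1 + 2 * t3 * y$3 + t6 * y$2) = 0"
      "y$5 * (2 * t4 * y$4 + t5 * y$5 + t7 * y$2) = 0"
      "y$4 * (t4 * y$4 + 2 * t5 * y$5 + t7 * y$2) = 0"
      "3 * t2 * (y$2)\<^sup>2 + t6 * y$1 * y$3 + t7 * y$4 * y$5 = 0"
    unfolding forall_5 partial_deriv_cubic_Y by blast+
  \<comment> \<open>This keeps the lifted point nonzero even if both lifted pairs are zero.\<close>
  have "y$2 \<noteq> 0"
  proof
    assume 0: "y$2 = 0"
    have "y$1 = 0 \<and> y$3 = 0"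
      by (rule singular_pair_eq_0 [OF t(1,2)]) (use d(1,2) 0 in simp_all)
    moreover have "y$4 = 0 \<and> y$5 = 0"
      by (rule singular_pair_eq_0 [OF t(3,4)]) (use d(3,4) 0 in simp_all)
    ultimately show False
      using y 0 by (simp add: vec_eq_5)
  qed
  obtain u w where uw: "u * w = y$1 * y$3" "3 * t1 * u\<^sup>2 + t6 * y$2 * w = 0" "3 * t3 * w\<^sup>2 + t6 * y$2 * u = 0"
    using singular_pair_lift [OF d(1,2)] .
  obtain u' w' where uw': "u' * w' = y$4 * y$5" "3 * t4 * u'\<^sup>2 + t7 * y$2 * w' = 0" "3 * t5 * w'\<^sup>2 + t7 * y$2 * u' = 0"
    using singular_pair_lift [OF d(3,4)] .
  have d2: "3 * t2 * (y$2)\<^sup>2 + t6 * u * w + t7 * u' * w' = 0"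
    using d(5) uw(1) uw'(1) by algebra
  define x where "x = (vector [u, y$2, w, u', w'] :: complex ^ 5)"
  have "x \<noteq> 0"
    using \<open>y$2 \<noteq> 0\<close> by (auto simp: x_def vec_eq_5)
  moreover have "cubic_X t1 t2 t3 t4 t5 t6 t7 x = 0"
  proof -
    \<comment> \<open>Euler's relation: three times the cubic is the sum of the coordinates times
      the partial derivatives.\<close>
    have "3 * cubic_X t1 t2 t3 t4 t5 t6 t7 x =
        u * (3 * t1 * u\<^sup>2 + t6 * y$2 * w) + w * (3 * t3 * w\<^sup>2 + t6 * y$2 * u) +
        u' * (3 * t4 * u'\<^sup>2 + t7 * y$2 * w') + w' * (3 * t5 * w'\<^sup>2 + t7 * y$2 * u') +
        y$2 * (3 * t2 * (y$2)\<^sup>2 + t6 * u * w + t7 * u' * w')"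
      unfolding cubic_X_def x_def vector_5
      by (simp add: algebra_simps power2_eq_square power3_eq_cube)
    then have "3 * cubic_X t1 t2 t3 t4 t5 t6 t7 x = 0"
      unfolding uw(2,3) uw'(2,3) d2 by simp
    then show ?thesis by simp
  qed
  moreover have "\<forall>i. partial_deriv i (cubic_X t1 t2 t3 t4 t5 t6 t7) x = 0"
    unfolding forall_5 partial_deriv_cubic_X x_def vector_5 using uw uw' d2 by blast
  ultimately show False
    using smooth unfolding smooth_hypersurface_def by blast
qed

section \<open>The Fermat cubic\<close>

lemma fmorphism_compose:
  assumes "fmorphism A B \<phi>" "fmorphism B C \<psi>"
  shows "fmorphism A C (\<psi> \<circ> \<phi>)"
  unfolding fmorphism_def
proof (intro conjI allI impI)
  have "continuous_map (topo A) (topo B) \<phi>" "continuous_map (topo B) (topo C) \<psi>"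
    using assms by (simp_all add: fmorphism_def)
  then show "continuous_map (topo A) (topo C) (\<psi> \<circ> \<phi>)"
    by (rule continuous_map_compose)
  fix W f assume W: "openin (topo C) W \<and> reg C W f"
  define V where "V = {y \<in> topspace (topo B). \<psi> y \<in> W}"
  have "openin (topo B) V" "reg B V (f \<circ> \<psi>)"
    using W assms(2) unfolding fmorphism_def continuous_map_def V_def by blast+
  then have "reg A {x \<in> topspace (topo A). \<phi> x \<in> V} ((f \<circ> \<psi>) \<circ> \<phi>)"
    using assms(1) unfolding fmorphism_def by blast
  moreover have "{x \<in> topspace (topo A). \<phi> x \<in> V} = {x \<in> topspace (topo A). (\<psi> \<circ> \<phi>) x \<in> W}"
    using assms(1) unfolding fmorphism_def continuous_map_def V_def by auto
  ultimately show "reg A {x \<in> topspace (topo A). (\<psi> \<circ> \<phi>) x \<in> W} (f \<circ> (\<psi> \<circ> \<phi>))"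
    by (simp add: comp_assoc)
qed

lemma fmorphism_restrict:
  assumes \<phi>: "fmorphism A B \<phi>" and V: "openin (topo B) V"
    and U: "U = {x \<in> topspace (topo A). \<phi> x \<in> V}"
  shows "fmorphism (open_subspace A U) (open_subspace B V) \<phi>"
proof -
  have oU: "openin (topo A) U"
    using \<phi> V unfolding U fmorphism_def continuous_map_def by blast
  have eq: "{x \<in> U. \<phi> x \<in> W} = {x \<in> topspace (topo A). \<phi> x \<in> W}" if "W \<subseteq> V" for W
    using that unfolding U by blast
  show ?thesis
    unfolding fmorphism_def continuous_map_def reg_open_subspace
      openin_open_subspace_iff [OF oU] openin_open_subspace_iff [OF V]
      topspace_open_subspace [OF oU] topspace_open_subspace [OF V]
  proof (intro conjI allI impI)
    show "\<phi> \<in> U \<rightarrow> V"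
      unfolding U by blast
    show "openin (topo A) {x \<in> U. \<phi> x \<in> W}" if "openin (topo B) W \<and> W \<subseteq> V" for W
      using that \<phi> eq [of W] unfolding fmorphism_def continuous_map_def by simp
    show "{x \<in> U. \<phi> x \<in> W} \<subseteq> U" for W
      by blast
    show "reg A {x \<in> U. \<phi> x \<in> W} (f \<circ> \<phi>)" if "(openin (topo B) W \<and> W \<subseteq> V) \<and> reg B W f" for W f
      using that \<phi> eq [of W] unfolding fmorphism_def by simp
  qed
qed

lemma birational_fisomorphic:
  assumes "birational A B" "fisomorphic B C"
  shows "birational A C"
proof -
  obtain U V \<alpha> \<beta> where U: "openin (topo A) U" "Abstract_Topology.closure_of (topo A) U = topspace (topo A)"
    and V: "openin (topo B) V" "Abstract_Topology.closure_of (topo B) V = topspace (topo B)"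
    and \<alpha>: "fmorphism (open_subspace A U) (open_subspace B V) \<alpha>"
    and \<beta>: "fmorphism (open_subspace B V) (open_subspace A U) \<beta>"
    and \<alpha>\<beta>: "\<forall>x\<in>U. \<beta> (\<alpha> x) = x" "\<forall>y\<in>V. \<alpha> (\<beta> y) = y"
    using assms(1) unfolding birational_def fisomorphic_def by (metis topspace_open_subspace)
  obtain \<phi> \<psi> where \<phi>: "fmorphism B C \<phi>" and \<psi>: "fmorphism C B \<psi>"
    and \<phi>\<psi>: "\<forall>x\<in>topspace (topo B). \<psi> (\<phi> x) = x" "\<forall>z\<in>topspace (topo C). \<phi> (\<psi> z) = z"
    using assms(2) unfolding fisomorphic_def by blast
  have in_B: "\<psi> z \<in> topspace (topo B)" if "z \<in> topspace (topo C)" for z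
    using \<psi> that unfolding fmorphism_def continuous_map_def by blast
  have in_C: "\<phi> y \<in> topspace (topo C)" if "y \<in> topspace (topo B)" for y
    using \<phi> that unfolding fmorphism_def continuous_map_def by blast
  define V' where "V' = {z \<in> topspace (topo C). \<psi> z \<in> V}"
  have V': "openin (topo C) V'"
    using \<psi> V(1) unfolding V'_def fmorphism_def continuous_map_def by blast
  have V_B: "V \<subseteq> topspace (topo B)"
    using V(1) by (rule openin_subset)
  \<comment> \<open>Writing \<open>V\<close> as the preimage of \<open>V'\<close> under
    \<open>\<phi>\<close> makes the restriction lemma apply in both directions.\<close>
  then have V_eq: "V = {y \<in> topspace (topo B). \<phi> y \<in> V'}"
    unfolding V'_def using in_C \<phi>\<psi>(1) by auto
  have \<alpha>_V: "\<alpha> x \<in> V" if "x \<in> U" for x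
    using \<alpha> that U(1) V(1) unfolding fmorphism_def continuous_map_def
    by (auto simp: topspace_open_subspace)
  have dense: "Abstract_Topology.closure_of (topo C) V' = topspace (topo C)"
    unfolding dense_intersects_open
  proof (intro allI impI)
    fix T assume T: "openin (topo C) T \<and> T \<noteq> {}"
    then obtain z where z: "z \<in> T" "z \<in> topspace (topo C)"
      using openin_subset by blast
    let ?S = "{y \<in> topspace (topo B). \<phi> y \<in> T}"
    have "openin (topo B) ?S"
      using T \<phi> unfolding fmorphism_def continuous_map_def by blast
    moreover have "\<psi> z \<in> ?S"
      using z in_B \<phi>\<psi>(2) by simp
    ultimately obtain y where "y \<in> V" "y \<in> ?S"
      using V(2) unfolding dense_intersects_open by blast
    then show "V' \<inter> T \<noteq> {}"
      using V_eq by blast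
  qed
  have "fmorphism (open_subspace A U) (open_subspace C V') (\<phi> \<circ> \<alpha>)"
    by (rule fmorphism_compose [OF \<alpha> fmorphism_restrict [OF \<phi> V' V_eq]])
  moreover have "fmorphism (open_subspace C V') (open_subspace A U) (\<beta> \<circ> \<psi>)"
    by (rule fmorphism_compose [OF fmorphism_restrict [OF \<psi> V(1) V'_def] \<beta>])
  moreover have "\<forall>x\<in>U. (\<beta> \<circ> \<psi>) ((\<phi> \<circ> \<alpha>) x) = x"
    using \<alpha>_V V_B \<phi>\<psi>(1) \<alpha>\<beta>(1) by (metis comp_apply subsetD)
  moreover have "\<forall>z\<in>V'. (\<phi> \<circ> \<alpha>) ((\<beta> \<circ> \<psi>) z) = z"
    unfolding V'_def using \<phi>\<psi>(2) \<alpha>\<beta>(2) by auto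
  ultimately have "fisomorphic (open_subspace A U) (open_subspace C V')"
    unfolding fisomorphic_def topspace_open_subspace [OF U(1)] topspace_open_subspace [OF V'] by blast
  then show ?thesis
    unfolding birational_def using U V' dense by blast
qed

lemma fmorphism_proj_map:
  assumes \<Phi>: "\<And>i. homogeneous e (\<lambda>x. \<Phi> x $ i)"
    and X: "X \<subseteq> projective_space" and Y: "Y \<subseteq> projective_space"
    and maps: "\<And>x. x \<noteq> 0 \<Longrightarrow> hpt x \<in> X \<Longrightarrow> \<Phi> x \<noteq> 0 \<and> hpt (\<Phi> x) \<in> Y"
  shows "fmorphism (proj_variety X) (proj_variety Y) (proj_map \<Phi>)"
proof -
  have D: "openin (topo (proj_variety X)) X"
    using openin_topspace [of "topo (proj_variety X)"] by (simp add: topspace_proj_variety X)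
  have "proj_map \<Phi> p \<in> Y" if p: "p \<in> X" for p
  proof -
    obtain x where x: "x \<noteq> 0" "p = hpt x"
      by (rule projective_space_cases [OF subsetD [OF X p]])
    then show ?thesis
      using maps [of x] p proj_map_hpt [OF \<Phi> x(1)] by simp
  qed
  then show ?thesis
    unfolding fmorphism_def continuous_map_def
    using openin_proj_map_preimage [OF \<Phi> X Y D maps] reg_proj_map_pullback [OF \<Phi> X Y D maps]
    by (simp add: topspace_proj_variety X Y)
qed

lemma fisomorphic_hypersurfaces:
  fixes \<Phi> :: "complex ^ 'n::finite \<Rightarrow> complex ^ 'm::finite"
  assumes \<Phi>: "\<And>i. homogeneous 1 (\<lambda>x. \<Phi> x $ i)" and \<Psi>: "\<And>i. homogeneous 1 (\<lambda>x. \<Psi> x $ i)"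
    and inv: "\<And>x. \<Psi> (\<Phi> x) = x" "\<And>y. \<Phi> (\<Psi> y) = y"
    and F: "homogeneous d F" "homogeneous d H" "\<And>x. H (\<Phi> x) = F x"
  shows "fisomorphic (proj_variety (hypersurface F)) (proj_variety (hypersurface H))"
proof -
  \<comment> \<open>Linear forms vanish at the origin, so the mutually inverse maps preserve nonzero
    vectors.\<close>
  have "\<Phi> (0 *s 0) $ i = 0 ^ 1 * \<Phi> 0 $ i" "\<Psi> (0 *s 0) $ j = 0 ^ 1 * \<Psi> 0 $ j" for i j
    by (intro homogeneous_scale \<Phi> \<Psi>)+
  then have 0: "\<Phi> 0 = 0" "\<Psi> 0 = 0"
    by (simp_all add: vec_eq_iff)
  have 1: "fmorphism (proj_variety (hypersurface F)) (proj_variety (hypersurface H)) (proj_map \<Phi>)"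
  proof (rule fmorphism_proj_map [OF \<Phi> zero_locus_subset zero_locus_subset])
    fix x :: "complex ^ 'n" assume "x \<noteq> 0" "hpt x \<in> hypersurface F"
    with F show "\<Phi> x \<noteq> 0 \<and> hpt (\<Phi> x) \<in> hypersurface H"
      by (metis hpt_in_hypersurface_iff inv(1) 0(2))
  qed
  have 2: "fmorphism (proj_variety (hypersurface H)) (proj_variety (hypersurface F)) (proj_map \<Psi>)"
  proof (rule fmorphism_proj_map [OF \<Psi> zero_locus_subset zero_locus_subset])
    fix y :: "complex ^ 'm" assume "y \<noteq> 0" "hpt y \<in> hypersurface H"
    with F show "\<Psi> y \<noteq> 0 \<and> hpt (\<Psi> y) \<in> hypersurface F"
      by (metis hpt_in_hypersurface_iff inv(2) 0(1))
  qed
  have 3: "proj_map \<Psi> (proj_map \<Phi> p) = p" if "p \<in> projective_space" for p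
    using that by (elim projective_space_cases) (metis proj_map_hpt [OF \<Phi>] proj_map_hpt [OF \<Psi>] inv(1) 0(2))
  have 4: "proj_map \<Phi> (proj_map \<Psi> p) = p" if "p \<in> projective_space" for p
    using that by (elim projective_space_cases) (metis proj_map_hpt [OF \<Phi>] proj_map_hpt [OF \<Psi>] inv(2) 0(1))
  show ?thesis
    unfolding fisomorphic_def topspace_proj_variety [OF zero_locus_subset]
    by (intro exI [of _ "proj_map \<Phi>"] exI [of _ "proj_map \<Psi>"] conjI ballI 1 2 3 4
        subsetD [OF zero_locus_subset])
qed

lemma fermat_cubic_eq: "fermat_cubic = cubic_X 1 1 1 1 1 0 0"
  by (rule ext) (simp add: fermat_cubic_def cubic_X_def sum_5)

context cube_root
begin

text \<open>
  With \<open>\<sigma> = \<xi> - \<xi>^2\<close>, i.e. \<open>\<sigma>^2 = -3\<close>, one has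
  \<open>(u - \<xi> v)^3 - (u - \<xi>^2 v)^3 = \<sigma>^3 (u^2 v + u v^2)\<close>.
\<close>

lemma fisomorphic_fermat:
  "fisomorphic (proj_variety (hypersurface (cubic_Y 1 1 1 1 1 0 0)))
     (proj_variety (hypersurface fermat_cubic))"
proof -
  define \<sigma> where "\<sigma> = \<xi> - \<xi>\<^sup>2"
  have "\<sigma>\<^sup>2 = - 3"
    unfolding \<sigma>_def using xi_sq by algebra
  then have \<sigma>: "\<sigma> \<noteq> 0" by auto
  define c where "c = inverse \<sigma>"
  have c: "c * \<xi> - c * \<xi>\<^sup>2 = 1"
  proof -
    have "c * \<sigma> = 1"
      using \<sigma> by (simp add: c_def)
    then show ?thesis
      by (simp add: \<sigma>_def right_diff_distrib)
  qed
  \<comment> \<open>Each pair is sent to \<open>c\<close> times u - \<open>\<xi>\<close> v and minus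
    \<open>c\<close> times u - \<open>\<xi>\<^sup>2\<close> v. All coefficients are explicit, even
    1, so that the closure rules for linear forms match.\<close>
  define \<Phi> where "\<Phi> y = (vector [c * y$1 + (- c * \<xi>) * y$3, 1 * y$2, - c * y$1 + c * \<xi>\<^sup>2 * y$3,
     c * y$4 + (- c * \<xi>) * y$5, - c * y$4 + c * \<xi>\<^sup>2 * y$5] :: complex ^ 5)" for y :: "complex ^ 5"
  \<comment> \<open>Solves for the pair: since \<open>c * \<sigma> = 1\<close>, the sum of the two
    images is -v, and \<open>\<xi>\<^sup>2\<close> times the first plus \<open>\<xi>\<close> times
    the second is -u.\<close>
  define \<Psi> where "\<Psi> x = (vector [- (\<xi>\<^sup>2) * x$1 + (- \<xi>) * x$3, 1 * x$2, - 1 * x$1 + - 1 * x$3,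
     - (\<xi>\<^sup>2) * x$4 + (- \<xi>) * x$5, - 1 * x$4 + - 1 * x$5] :: complex ^ 5)" for x :: "complex ^ 5"
  have "\<forall>i. homogeneous 1 (\<lambda>x. \<Phi> x $ i)" "\<forall>i. homogeneous 1 (\<lambda>x. \<Psi> x $ i)"
    unfolding forall_5 \<Phi>_def \<Psi>_def vector_5
    by (intro conjI homogeneous_add homogeneous_cmult homogeneous_coord)+
  moreover have "\<Psi> (\<Phi> y) = y" for y
  proof -
    have "- (\<xi>\<^sup>2) * (c * u + (- c * \<xi>) * v) + (- \<xi>) * (- c * u + c * \<xi>\<^sup>2 * v) = u"
      "- 1 * (c * u + (- c * \<xi>) * v) + - 1 * (- c * u + c * \<xi>\<^sup>2 * v) = v" for u v
      using c by algebra+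
    then show ?thesis
      unfolding \<Phi>_def \<Psi>_def vector_5 vec_eq_5 by simp
  qed
  moreover have "\<Phi> (\<Psi> x) = x" for x
  proof -
    have "c * (- (\<xi>\<^sup>2) * u + (- \<xi>) * v) + (- c * \<xi>) * (- 1 * u + - 1 * v) = u"
      "- c * (- (\<xi>\<^sup>2) * u + (- \<xi>) * v) + c * \<xi>\<^sup>2 * (- 1 * u + - 1 * v) = v" for u v
      using c by algebra+
    then show ?thesis
      unfolding \<Phi>_def \<Psi>_def vector_5 vec_eq_5 by simp
  qed
  moreover have "fermat_cubic (\<Phi> y) = cubic_Y 1 1 1 1 1 0 0 y" for y
  proof -
    \<comment> \<open>With \<open>c = 1 / \<sigma>\<close> the left side is
      \<open>- 3 * c\<^sup>2\<close>, which is 1 because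
      \<open>\<sigma>\<^sup>2 = - 3\<close>.\<close>
    have c3: "3 * c ^ 3 * (\<xi>\<^sup>2 - \<xi>) = 1"
      using c xi_sq by algebra
    have cubes: "(c * u + (- c * \<xi>) * v) ^ 3 + (- c * u + c * \<xi>\<^sup>2 * v) ^ 3 = u\<^sup>2 * v + u * v\<^sup>2" for u v
      using c3 xi_sq xi3 by algebra
    show ?thesis
      unfolding fermat_cubic_eq cubic_X_def cubic_Y_def \<Phi>_def vector_5
      using cubes [of "y$1" "y$3"] cubes [of "y$4" "y$5"] by (simp add: algebra_simps)
  qed
  ultimately show ?thesis
    using homogeneous_cubic_X homogeneous_cubic_Y unfolding fermat_cubic_eq
    by (intro fisomorphic_hypersurfaces [where \<Phi> = \<Phi> and \<Psi> = \<Psi>]) blast+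
qed

end

theorem theorem3p1:
  fixes \<xi> :: complex
  assumes "primitive_root_of_unity 3 \<xi>"
  shows "(\<forall>t1 t2 t3 t4 t5 t6 t7 :: complex.
            t1 \<noteq> 0 \<and> t2 \<noteq> 0 \<and> t3 \<noteq> 0 \<and> t4 \<noteq> 0 \<and> t5 \<noteq> 0 \<and>
            smooth_hypersurface (cubic_X t1 t2 t3 t4 t5 t6 t7) \<longrightarrow>
              smooth_hypersurface (cubic_Y t1 t2 t3 t4 t5 t6 t7) \<and>
              birational
                (quotient_variety (hypersurface (cubic_X t1 t2 t3 t4 t5 t6 t7)) (G12 \<xi>))
                (proj_variety (hypersurface (cubic_Y t1 t2 t3 t4 t5 t6 t7))))
       \<and> birational
            (quotient_variety (hypersurface fermat_cubic) (G12 \<xi>))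
            (proj_variety (hypersurface fermat_cubic))"
proof (intro conjI allI impI)
  have "birational (quotient_variety (hypersurface fermat_cubic) (G12 \<xi>))
      (proj_variety (hypersurface (cubic_Y 1 1 1 1 1 0 0)))"
    unfolding fermat_cubic_eq by (rule birational_quotient_cubic [OF assms]) simp
  then show "birational (quotient_variety (hypersurface fermat_cubic) (G12 \<xi>))
      (proj_variety (hypersurface fermat_cubic))"
    using cube_root.fisomorphic_fermat [OF cube_root.intro [OF assms]]
    by (rule birational_fisomorphic)
qed (auto intro: smooth_cubic_Y birational_quotient_cubic assms)

end
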